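(* Let $0<k_1\le k_2$, $0<c<1$, $x_1,x_2\in\mathbb Z_{\ge0}$, $p\in\mathbb Z$ and $y\in\mathbb R$. Then $$S_{x_2}\!\left(y;k_2-k_1+\tfrac12,\,k_1+k_2-\tfrac12,\,k_1-k_2+x_1-x_2+\tfrac12\right)\frac1{\Gamma(p+x_2-x_1+1)}\,{}_2F_1\!\left({p+k_1-k_2+\frac12+i\sqrt y,\ p+k_1-k_2+\frac12-i\sqrt y\atop p+x_2-x_1+1};\frac c{c-1}\right)$$ $$=\sum_{n=0}^\infty C_n\,S_n\!\left(y;k_2-k_1+\tfrac12,\,k_1+k_2-\tfrac12,\,k_1-k_2+p+\tfrac12\right)M_{n+p}(x_1;2k_1,c)\,M_n(x_2;2k_2,c),$$ where $$C_n=(-1)^{x_1+x_2}\,\frac{c^{\,n+x_1}(1-c)^{2k_1+p}(2k_1)_{x_1}(2k_2)_{x_2}}{\Gamma(n+1)\,\Gamma(n+p+1)}.$$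
   Context: Continuous dual Hahn polynomials: $S_n(y;a,b,c)=(a+b)_n(a+c)_n\,{}_3F_2\!\left({-n,\,a+ix,\,a-ix\atop a+b,\,a+c};1\right)$ with $x^2=y$, understood as the polynomial $$S_n(y;a,b,c)=\sum_{j=0}^n\frac{(-n)_j(a+ix)_j(a-ix)_j}{j!}(a+b+j)_{n-j}(a+c+j)_{n-j}$$ (so that it also makes sense when $a+b$ or $a+c$ is a non-positive integer). Meixner polynomials: $M_n(x;\beta,c)={}_2F_1\!\left({-n,\,-x\atop\beta};1-\frac1c\right)$ for $n,x\in\mathbb Z_{\ge0}$. $(a)_n=a(a+1)\cdots(a+n-1)$ is the Pochhammer symbol; $1/\Gamma$ vanishes at non-positive integers, so terms with $n+p<0$ on the right-hand side are $0$. The product $\frac1{\Gamma(C)}{}_2F_1(A,B;C;z)$ is the regularized hypergeometric function, i.e. (the analytic continuation to $z\in\mathbb C\setminus[1,\infty)$ of) $\sum_{k\ge0}\frac{(A)_k(B)_k}{\Gamma(C+k)\,k!}z^k$, which is defined for all $C$. Either choice of $\sqrt y$ gives the same expression. *)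

theory Defs
  imports "HOL-Analysis.Analysis"
begin

text \<open>
  Continuous dual Hahn polynomials in the variable \<open>y\<close>. The summand is even in \<open>x\<close>, so the
  choice of the square root \<open>x\<close> of \<open>y\<close> is immaterial.
\<close>

definition cont_dual_hahn :: "nat \<Rightarrow> complex \<Rightarrow> complex \<Rightarrow> complex \<Rightarrow> complex \<Rightarrow> complex" where
  "cont_dual_hahn n y a b c =
     (let x = csqrt y in
      \<Sum>j=0..n. pochhammer (- of_nat n) j * pochhammer (a + \<i> * x) j * pochhammer (a - \<i> * x) j / fact j
              * pochhammer (a + b + of_nat j) (n - j) * pochhammer (a + c + of_nat j) (n - j))"

text \<open>
  Meixner polynomials at \<open>x \<in> \<nat>\<close>: the series \<open>\<^sub>2F\<^sub>1(-n, -x; \<beta>; 1 - 1/c)\<close>, whose terms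
  of index \<open>k > n\<close> vanish.
\<close>

definition meixner :: "nat \<Rightarrow> nat \<Rightarrow> real \<Rightarrow> real \<Rightarrow> real" where
  "meixner n x \<beta> c =
     (\<Sum>k=0..n. pochhammer (- real n) k * pochhammer (- real x) k / (pochhammer \<beta> k * fact k)
              * (1 - 1 / c) ^ k)"

text \<open>
  The regularized hypergeometric function \<open>\<^sub>2F\<^sub>1(A, B; C; z) / \<Gamma>(C)\<close>: the analytic continuation
  of the power series from the open unit disc to the slit plane \<open>\<complex> - [1, \<infinity>)\<close>.
  It is unique there by the identity theorem; values on the cut are irrelevant. The function
  \<open>rGamma\<close> is \<open>1 / \<Gamma>\<close>, with value \<open>0\<close> at the non-positive integers.
\<close>

definition slit_plane :: "complex set" where
  "slit_plane = - (complex_of_real ` {1..})"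

definition hyp2F1_reg :: "complex \<Rightarrow> complex \<Rightarrow> complex \<Rightarrow> complex \<Rightarrow> complex" where
  "hyp2F1_reg A B C =
     (SOME f. f holomorphic_on slit_plane \<and>
        (\<forall>z\<in>ball 0 1.
           (\<lambda>k. pochhammer A k * pochhammer B k * rGamma (C + of_nat k) / fact k * z ^ k) sums f z))"

end

theory Submission
  imports Defs "HOL-Complex_Analysis.Complex_Analysis"
begin

text \<open>
  Write \<open>F(C)\<close> for the regularized hypergeometric function and \<open>S\<^sub>n(d)\<close> for the continuous dual Hahn
  polynomial as a function of its third parameter. For \<open>x\<^sub>1 = x\<^sub>2 = 0\<close> the claim is the generating
  function of the \<open>S\<^sub>n\<close>, transformed by Pfaff. The case \<open>x\<^sub>2 = 0\<close> follows by induction on \<open>x\<^sub>1\<close>,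
  for all \<open>p\<close> at once: \<open>F(A, B; C - 1)\<close> is a combination of \<open>F(A, B; C)\<close> and \<open>F(A + 1, B + 1; C + 1)\<close>,
  and on the other side the factor \<open>A B\<close> is absorbed by the relation between \<open>S\<^sub>n(d + 1)\<close>,
  \<open>S\<^sub>n(d)\<close> and \<open>S\<^sub>n\<^sub>+\<^sub>1(d)\<close>, up to a telescoping sum. Finally, subtracting the Meixner difference
  equations in \<open>x\<^sub>1\<close> and \<open>x\<^sub>2\<close> eliminates \<open>n\<close>, because the degrees differ by the constant \<open>p\<close>.
  This gives a recurrence that raises \<open>x\<^sub>2\<close>; the left-hand side satisfies it by the contiguous
  relation between \<open>F(C - 1)\<close>, \<open>F(C)\<close>, \<open>F(C + 1)\<close> and two shift relations for \<open>S\<^sub>n(d)\<close>.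
\<close>

section \<open>The slit plane\<close>

lemma open_slit_plane: "open slit_plane"
proof -
  have "closed (complex_of_real ` {1..})"
    by (intro closed_injective_linear_image closed_atLeast) (auto simp: inj_on_def bounded_linear.linear bounded_linear_of_real)
  thus ?thesis unfolding slit_plane_def by (simp add: open_Compl)
qed

text \<open>In this form membership is the side condition of \<open>csqrt\<close> at
  \<open>1 - z\<close>, whose branch cut is the non-positive real axis.\<close>

lemma slit_plane_iff: "z \<in> slit_plane \<longleftrightarrow> 1 - z \<notin> \<real>\<^sub>\<le>\<^sub>0"
proof -
  have "1 - z \<in> \<real>\<^sub>\<le>\<^sub>0 \<longleftrightarrow> z \<in> complex_of_real ` {1..}"
    by (auto simp: complex_nonpos_Reals_iff image_iff complex_eq_iff intro!: exI[of _ "Re z"])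
  thus ?thesis by (simp add: slit_plane_def)
qed

lemma zero_in_slit_plane [simp]: "0 \<in> slit_plane"
  by (simp add: slit_plane_iff)

lemma unit_ball_subset_slit_plane: "ball 0 1 \<subseteq> slit_plane"
proof
  fix z :: complex assume "z \<in> ball 0 1"
  hence "Re z < 1" using abs_Re_le_cmod[of z] by simp
  thus "z \<in> slit_plane" by (simp add: slit_plane_iff complex_nonpos_Reals_iff)
qed

lemma connected_slit_plane: "connected slit_plane"
proof (rule starlike_imp_connected)
  show "starlike slit_plane" unfolding starlike_def
  proof (intro bexI ballI subsetI)
    fix z w assume z: "z \<in> slit_plane" and w: "w \<in> closed_segment 0 z"
    from w obtain u where u: "0 \<le> u" "u \<le> 1" "w = of_real u * z"
      by (auto simp: closed_segment_def scaleR_conv_of_real)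
    show "w \<in> slit_plane"
    proof (rule ccontr)
      assume "w \<notin> slit_plane"
      hence *: "Re w \<ge> 1" "Im w = 0" by (auto simp: slit_plane_iff complex_nonpos_Reals_iff)
      \<comment> \<open>The slit starts at 1, so a segment from 0 can meet it only at a positive
        parameter; stretching by \<open>1 / u \<ge> 1\<close> then keeps the endpoint on the
        slit.\<close>
      hence "u > 0" using u by (cases "u = 0") auto
      with * u have "Im z = 0" "Re z \<ge> 1 / u" by (auto simp: field_simps)
      moreover have "1 / u \<ge> 1" using u \<open>u > 0\<close> by simp
      ultimately show False using z by (auto simp: slit_plane_iff complex_nonpos_Reals_iff)
    qed
  qed simp
qed

section \<open>The hypergeometric series and its quadratic transformation\<close>

text \<open>The Taylor series at 0 of the regularized function. Identities are proved on its
  coefficients and carried to the slit plane afterwards.\<close>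

definition hyp_fps :: "complex \<Rightarrow> complex \<Rightarrow> complex \<Rightarrow> complex fps" where
  "hyp_fps A B C = Abs_fps (\<lambda>k. pochhammer A k * pochhammer B k * rGamma (C + of_nat k) / fact k)"

text \<open>Division free in \<open>C\<close>, so that non-positive integers \<open>C\<close> need
  no separate case: the functional equation of \<open>rGamma\<close> supplies the factor
  \<open>C + k\<close>.\<close>

lemma hyp_fps_nth_Suc:
  "of_nat (Suc k) * (C + of_nat k) * fps_nth (hyp_fps A B C) (Suc k) = (A + of_nat k) * (B + of_nat k) * fps_nth (hyp_fps A B C) k"
proof -
  have "rGamma (C + of_nat k) = (C + of_nat k) * rGamma (C + of_nat (Suc k))"
    using rGamma_plus1[of "C + of_nat k"] by (simp add: add_ac)
  thus ?thesis
    unfolding hyp_fps_def fps_nth_Abs_fps pochhammer_Suc fact_Suc of_nat_mult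
    by (simp add: field_simps del: of_nat_Suc)
qed

text \<open>Gauss's hypergeometric equation; its coefficient of degree \<open>n\<close> is the term
  ratio \<open>hyp_fps_nth_Suc\<close>.\<close>

lemma hyp_fps_ode:
  "fps_X * (1 - fps_X) * fps_deriv (fps_deriv (hyp_fps A B C))
   + (fps_const C - (fps_const A + fps_const B + 1) * fps_X) * fps_deriv (hyp_fps A B C)
   - fps_const A * fps_const B * hyp_fps A B C = 0" (is "?l = 0")
proof (rule fps_ext)
  fix n
  show "fps_nth ?l n = fps_nth 0 n"
    using hyp_fps_nth_Suc[of n C A B]
    by (cases n) (simp_all add: algebra_simps fps_mult_nth_0)
qed

section \<open>The quadratic transformation as an identity of formal power series\<close>

lemma fps_binomial_minus_one_inverse: "(1 + fps_X) * fps_binomial (-1) = (1 :: complex fps)"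
  using fps_binomial_add_mult[of 1 "-1::complex"] by (simp add: fps_binomial_1)

lemma fps_deriv_binomial: "fps_deriv (fps_binomial c) = fps_const c * fps_binomial c * fps_binomial (-1 :: complex)"
  by (simp add: fps_binomial_deriv fps_binomial_minus_one fps_divide_unit)

text \<open>
  The map \<open>w \<mapsto> 4 w / (1 + w)\<^sup>2\<close> takes the unit disc onto the slit plane. The factor \<open>(1 + w)\<^sup>-\<^sup>2\<^sup>A\<close>
  makes one of the local exponents at \<open>w = -1\<close> vanish, so that the transformed equation yields a
  three-term recurrence. Its coefficients tend to \<open>0\<close> and \<open>1\<close>, hence the transformed series
  converges in the whole disc.
\<close>

lemma quadratic_ode_algebra:
  fixes X Q E A B C F0 F1 F2 :: "'a::idom"
  assumes PQ: "(1 + X) * Q = 1"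
    and H: "4*X*Q^2 * (1 - 4*X*Q^2) * F2 + (C - (A + B + 1) * (4*X*Q^2)) * F1 - A * B * F0 = 0"
  shows "X * (1 - X^2) * (E * (4*A^2*Q^2 + 2*A*Q^2) * F0
      + E * (- 16*A*(1-X)*Q^4 - 4*Q^3 - 12*(1-X)*Q^4) * F1 + E * 16*(1-X)^2*Q^6 * F2)
     + (C + (2*C - 4*B) * X + (C - 4*A - 2) * X^2) * (E * (-2*A*Q) * F0 + E * 4 * (1-X)*Q^3 * F1)
     + (2*A*(C - 2*B) - 2*A*(2*A+1-C)*X) * E * F0 = 0"
  using assms by algebra

text \<open>By the chain rule, \<open>G\<close> and its two derivatives are combinations of
  \<open>F0\<close>, \<open>F1\<close>, \<open>F2\<close>, the hypergeometric series and its
  derivatives composed with \<open>Z\<close>. The Gauss equation composed with \<open>Z\<close>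
  eliminates \<open>F2\<close>; what remains is \<open>quadratic_ode_algebra\<close>, in which these
  series and \<open>Q = 1 / (1 + X)\<close> are plain ring elements.\<close>

lemma quadratic_ode:
  fixes A B C :: complex
  defines "G \<equiv> fps_binomial (-2*A) * (hyp_fps A B C oo (4 * fps_X * fps_binomial (-2)))"
  shows "fps_X * (1 - fps_X^2) * fps_deriv (fps_deriv G)
     + (fps_const C + (2 * fps_const C - 4 * fps_const B) * fps_X + (fps_const C - 4 * fps_const A - 2) * fps_X^2) * fps_deriv G
     + (2*fps_const A*(fps_const C - 2*fps_const B) - 2*fps_const A*(2*fps_const A+1-fps_const C)*fps_X) * G = 0"
proof -
  define Q :: "complex fps" where "Q = fps_binomial (-1)"
  define E where "E = fps_binomial (-2*A)"
  define Z :: "complex fps" where "Z = 4 * fps_X * Q^2"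
  define F0 where "F0 = hyp_fps A B C oo Z"
  define F1 where "F1 = fps_deriv (hyp_fps A B C) oo Z"
  define F2 where "F2 = fps_deriv (fps_deriv (hyp_fps A B C)) oo Z"
  have PQ: "(1 + fps_X) * Q = 1"
    by (simp add: Q_def fps_binomial_minus_one_inverse)
  have Q2: "fps_binomial (-2) = Q^2"
    unfolding Q_def by (simp add: fps_binomial_power)
  have Z0: "fps_nth Z 0 = 0"
    by (simp add: Z_def mult.assoc)
  have dQ: "fps_deriv Q = - (Q^2)"
    unfolding Q_def using fps_deriv_binomial[of "-1"] by (simp add: power2_eq_square flip: fps_const_neg)
  have dE: "fps_deriv E = - 2 * fps_const A * E * Q"
    unfolding Q_def E_def using fps_deriv_binomial[of "-2*A"]
    by (simp flip: fps_const_neg fps_const_mult add: numeral_fps_const)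
  have dZ: "fps_deriv Z = 4 * Q^2 - 8 * fps_X * Q^3"
    unfolding Z_def by (simp add: fps_deriv_power dQ power2_eq_square power3_eq_cube algebra_simps)
  \<comment> \<open>One factor \<open>(1 + X) * Q = 1\<close> is inserted into the first summand,
    which exposes the critical point \<open>X = 1\<close> of \<open>Z\<close>.\<close>
  have dZ': "4 * Q^2 - 8 * fps_X * Q^3 = 4 * (1 - fps_X) * Q^3"
    using PQ by algebra
  have d0: "fps_deriv F0 = F1 * (4 * (1 - fps_X) * Q^3)"
    unfolding F0_def F1_def using dZ dZ' fps_compose_deriv[OF Z0] by metis
  have d1: "fps_deriv F1 = F2 * (4 * (1 - fps_X) * Q^3)"
    unfolding F2_def F1_def using dZ dZ' fps_compose_deriv[OF Z0] by metis
  have "(fps_X * (1 - fps_X) * fps_deriv (fps_deriv (hyp_fps A B C))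
   + (fps_const C - (fps_const A + fps_const B + 1) * fps_X) * fps_deriv (hyp_fps A B C)
   - fps_const A * fps_const B * hyp_fps A B C) oo Z = 0"
    unfolding hyp_fps_ode by simp
  hence H: "Z * (1 - Z) * F2 + (fps_const C - (fps_const A + fps_const B + 1) * Z) * F1 - fps_const A * fps_const B * F0 = 0"
    by (simp add: fps_compose_add_distrib fps_compose_sub_distrib fps_compose_mult_distrib[OF Z0] Z0
         F0_def F1_def F2_def del: fps_const_add fps_const_mult)
  have G: "G = E * F0"
    by (simp add: G_def E_def F0_def Z_def Q2)
  have G1: "fps_deriv G = E * (-2*fps_const A*Q) * F0 + E * 4 * (1-fps_X)*Q^3 * F1"
    unfolding G by (simp add: dE d0 algebra_simps)
  have dQ3: "fps_deriv (Q^3) = -3 * Q^4"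
    by (simp add: fps_deriv_power dQ numeral_eq_Suc algebra_simps)
  define a where "a = fps_const A"
  have da: "fps_deriv a = 0" by (simp add: a_def)
  have "fps_deriv (fps_deriv G) = fps_deriv (E * (-2*a*Q) * F0 + E * 4 * (1-fps_X)*Q^3 * F1)"
    unfolding G1 a_def ..
  also have "\<dots> = (-2*a*E*Q) * (-2*a*Q) * F0 + E * (2*a*Q^2) * F0 + E * (-2*a*Q) * (F1 * (4 * (1 - fps_X) * Q^3))
     + (-2*a*E*Q) * 4 * (1-fps_X)*Q^3 * F1 - E * 4 * Q^3 * F1 + E * 4 * (1-fps_X)*(-3*Q^4) * F1
     + E * 4 * (1-fps_X)*Q^3 * (F2 * (4 * (1 - fps_X) * Q^3))"
    by (simp only: fps_deriv_add fps_deriv_mult fps_deriv_sub dE[folded a_def] d0 d1 dQ dQ3 da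
         fps_deriv_fps_X fps_deriv_numeral fps_deriv_neg fps_deriv_1) (simp add: algebra_simps)
  also have "\<dots> = E * (4*a^2*Q^2 + 2*a*Q^2) * F0
      + E * (- 16*a*(1-fps_X)*Q^4 - 4*Q^3 - 12*(1-fps_X)*Q^4) * F1 + E * 16*(1-fps_X)^2*Q^6 * F2"
    by algebra
  finally have "fps_deriv (fps_deriv G) = E * (4*a^2*Q^2 + 2*a*Q^2) * F0
      + E * (- 16*a*(1-fps_X)*Q^4 - 4*Q^3 - 12*(1-fps_X)*Q^4) * F1 + E * 16*(1-fps_X)^2*Q^6 * F2" .
  with quadratic_ode_algebra[OF PQ H[unfolded Z_def], of E] G1 G show ?thesis
    unfolding a_def by (simp only: mult.assoc)
qed

lemma quadratic_rec:
  fixes A B C :: complex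
  defines "a \<equiv> fps_nth (fps_binomial (-2*A) * (hyp_fps A B C oo (4 * fps_X * fps_binomial (-2))))"
  shows "of_nat (n + 2) * (of_nat n + 1 + C) * a (n + 2) =
     - ((2 * C - 4 * B) * of_nat (n + 1) + 2 * A * (C - 2 * B)) * a (n + 1)
     + (of_nat n * (of_nat n - 1) - (C - 4 * A - 2) * of_nat n + 2 * A * (2 * A + 1 - C)) * a n"
proof -
  define G where "G = fps_binomial (-2*A) * (hyp_fps A B C oo (4 * fps_X * fps_binomial (-2)))"
  have n: "2 = fps_const (2::complex)" "4 = fps_const (4::complex)" "1 = fps_const (1::complex)"
    by (simp_all add: numeral_fps_const)
  \<comment> \<open>The equation is rewritten with nested multiplications by \<open>fps_X\<close>,
    that is, as index shifts, so that a coefficient can be read off.\<close>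
  have "fps_X * fps_deriv (fps_deriv G) - fps_X * (fps_X * (fps_X * fps_deriv (fps_deriv G)))
     + fps_const C * fps_deriv G + fps_const (2 * C - 4 * B) * (fps_X * fps_deriv G)
     + fps_const (C - 4 * A - 2) * (fps_X * (fps_X * fps_deriv G))
     + fps_const (2*A*(C - 2*B)) * G - fps_const (2*A*(2*A+1-C)) * (fps_X * G)
    = fps_X * (1 - fps_X^2) * fps_deriv (fps_deriv G)
     + (fps_const C + (2 * fps_const C - 4 * fps_const B) * fps_X + (fps_const C - 4 * fps_const A - 2) * fps_X^2) * fps_deriv G
     + (2*fps_const A*(fps_const C - 2*fps_const B) - 2*fps_const A*(2*fps_const A+1-fps_const C)*fps_X) * G"
    unfolding fps_const_add[symmetric] fps_const_sub[symmetric] fps_const_mult[symmetric] 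
      numeral_fps_const[symmetric] fps_const_1_eq_1
    by algebra
  also have "\<dots> = 0" unfolding G_def by (rule quadratic_ode)
  finally show ?thesis unfolding a_def G_def[symmetric]
    apply (drule_tac arg_cong[where f = "\<lambda>f. fps_nth f (Suc n)"])
    \<comment> \<open>The threefold shift of the second derivative has no coefficient of degree
      \<open>n + 1\<close> for \<open>n = 0\<close> and \<open>n = 1\<close>; these are the values
      where \<open>n * (n - 1)\<close> vanishes.\<close>
    by (cases n; cases "n - 1") (simp_all add: algebra_simps numeral_2_eq_2)
qed

section \<open>Growth of solutions of three-term recurrences\<close>

lemma three_term_growth:
  fixes a :: "nat \<Rightarrow> complex" and \<beta> \<gamma> :: "nat \<Rightarrow> complex"
  assumes rec: "eventually (\<lambda>n. a (n + 2) = \<beta> n * a (n + 1) + \<gamma> n * a n) sequentially"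
    and \<beta>: "\<beta> \<longlonglongrightarrow> 0" and \<gamma>: "\<gamma> \<longlonglongrightarrow> \<gamma>0" "norm \<gamma>0 \<le> 1" and \<rho>: "\<rho> > 1"
  obtains K where "\<And>n. norm (a n) \<le> K * \<rho> ^ n"
proof -
  \<comment> \<open>Chosen so that \<open>1 + 2 * e = \<rho>\<close>: once both coefficients are
    within \<open>e\<close> of their limiting bounds, one step of the recurrence reproduces the
    bound \<open>K * \<rho> ^ n\<close>.\<close>
  define e where "e = (\<rho> - 1) / 2"
  have e: "e > 0" using \<rho> by (simp add: e_def)
  have "eventually (\<lambda>n. norm (\<beta> n) < e) sequentially"
    using tendsto_norm[OF \<beta>] e by (simp add: order_tendstoD(2))
  moreover have "eventually (\<lambda>n. norm (\<gamma> n) < 1 + e) sequentially"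
    by (rule order_tendstoD(2)[OF tendsto_norm[OF \<gamma>(1)]]) (use e \<gamma>(2) in auto)
  ultimately have "eventually (\<lambda>n. norm (\<beta> n) < e \<and> norm (\<gamma> n) < 1 + e \<and> a (n + 2) = \<beta> n * a (n + 1) + \<gamma> n * a n) sequentially"
    using rec by eventually_elim auto
  then obtain N where N: "\<And>n. n \<ge> N \<Longrightarrow> norm (\<beta> n) < e" "\<And>n. n \<ge> N \<Longrightarrow> norm (\<gamma> n) < 1 + e"
      "\<And>n. n \<ge> N \<Longrightarrow> a (n + 2) = \<beta> n * a (n + 1) + \<gamma> n * a n"
    unfolding eventually_sequentially by blast
  \<comment> \<open>The maximum over the initial segment covers the indices that the recurrence
    estimate does not reach.\<close>
  define K where "K = Max ((\<lambda>n. norm (a n)) ` {..N+1})"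
  have small: "norm (a n) \<le> K" if "n \<le> N + 1" for n
    using that unfolding K_def by (intro Max_ge) auto
  have K: "K \<ge> 0" using small[of 0] by (meson norm_ge_zero order_trans zero_le)
  have "norm (a n) \<le> K * \<rho> ^ n" for n
  proof (induction n rule: less_induct)
    case (less n)
    show ?case
    proof (cases "n \<le> N + 1")
      case True
      have "K * 1 \<le> K * \<rho> ^ n" using K \<rho> by (intro mult_left_mono one_le_power) auto
      with small[OF True] show ?thesis by simp
    next
      case False
      then obtain m where m: "n = m + 2" "m \<ge> N"
        by (intro that[of "n - 2"]) auto
      have "norm (a n) \<le> norm (\<beta> m) * norm (a (m + 1)) + norm (\<gamma> m) * norm (a m)"
        unfolding m(1) N(3)[OF m(2)] by (intro norm_triangle_le) (simp add: norm_mult)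
      also have "\<dots> \<le> e * (K * \<rho> ^ (m + 1)) + (1 + e) * (K * \<rho> ^ m)"
        using N(1)[OF m(2)] N(2)[OF m(2)] less[of m] less[of "m + 1"] m e
        by (intro add_mono mult_mono) auto
      also have "\<dots> \<le> e * (K * \<rho> ^ (m + 1)) + (1 + e) * (K * \<rho> ^ (m + 1))"
        using e K \<rho> by (intro add_mono mult_left_mono power_increasing) auto
      also have "\<dots> = K * \<rho> ^ n"
        by (simp add: m e_def field_simps)
      finally show ?thesis .
    qed
  qed
  with that show ?thesis by blast
qed

lemma conv_radius_geometric_bound:
  fixes F :: "complex fps"
  assumes "\<And>\<rho>::real. \<rho> > 1 \<Longrightarrow> \<exists>K. \<forall>n. norm (fps_nth F n) \<le> K * \<rho> ^ n"
  shows "fps_conv_radius F \<ge> 1"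
  unfolding fps_conv_radius_def
proof (rule conv_radius_geI_ex')
  fix r :: real assume r: "0 < r" "ereal r < 1"
  \<comment> \<open>With \<open>s\<close> strictly between \<open>r\<close> and 1, the growth rate
    \<open>1 / s\<close> is admissible and leaves a geometric series of ratio
    \<open>r / s < 1\<close>.\<close>
  obtain s where s: "r < s" "s < 1" using r dense[of r 1] by auto
  then obtain K where K: "\<And>n. norm (fps_nth F n) \<le> K * (1/s) ^ n"
    using assms[of "1 / s"] r by auto
  show "summable (\<lambda>n. fps_nth F n * of_real r ^ n)"
  proof (rule summable_comparison_test'[where N = 0])
    show "summable (\<lambda>n. K * (r / s) ^ n)"
      using r s by (intro summable_mult summable_geometric) auto
    show "norm (fps_nth F n * of_real r ^ n) \<le> K * (r / s) ^ n" for n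
      using mult_right_mono[OF K[of n], of "r ^ n"] r
      by (simp add: norm_mult norm_power power_divide)
  qed
qed

text \<open>In the recurrence \<open>d\<close> and \<open>q\<close> are monic quadratics in
  \<open>n\<close> while \<open>p\<close> is at most linear. The leading coefficient
  \<open>d n\<close> vanishes for some \<open>n\<close> when \<open>C\<close> is a negative integer,
  hence the division by it is only carried out eventually.\<close>

lemma quadratic_conv_radius:
  fixes A B C :: complex
  shows "fps_conv_radius (fps_binomial (-2*A) * (hyp_fps A B C oo (4 * fps_X * fps_binomial (-2)))) \<ge> 1"
    (is "fps_conv_radius ?G \<ge> 1")
proof (rule conv_radius_geometric_bound)
  fix \<rho> :: real assume \<rho>: "\<rho> > 1"
  define d where "d = (\<lambda>n. of_nat (n + 2) * (of_nat n + 1 + C))"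
  define p where "p = (\<lambda>n. - ((2 * C - 4 * B) * of_nat (n + 1) + 2 * A * (C - 2 * B)))"
  define q where "q = (\<lambda>n. of_nat n * (of_nat n - 1) - (C - 4 * A - 2) * of_nat n + 2 * A * (2 * A + 1 - C))"
  have inv: "(\<lambda>n. inverse (of_nat n :: complex)) \<longlonglongrightarrow> 0"
    by (rule lim_inverse_n)
  have ev0: "eventually (\<lambda>n. n > 0) sequentially" by (rule eventually_gt_at_top)
  have d_lim: "(\<lambda>n. d n / of_nat n ^ 2) \<longlonglongrightarrow> 1"
  proof (rule Lim_transform_eventually)
    show "(\<lambda>n. (1 + 2 * inverse (of_nat n)) * (1 + (1 + C) * inverse (of_nat n))) \<longlonglongrightarrow> 1"
      by (rule tendsto_eq_rhs, (rule tendsto_intros inv)+) simp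
    show "\<forall>\<^sub>F n in sequentially. (1 + 2 * inverse (of_nat n)) * (1 + (1 + C) * inverse (of_nat n)) = d n / of_nat n ^ 2"
      using ev0 by eventually_elim (simp add: d_def field_simps power2_eq_square)
  qed
  have p_lim: "(\<lambda>n. p n / of_nat n ^ 2) \<longlonglongrightarrow> 0"
  proof (rule Lim_transform_eventually)
    show "(\<lambda>n. - ((2 * C - 4 * B) * (inverse (of_nat n) + inverse (of_nat n)^2) + 2 * A * (C - 2 * B) * inverse (of_nat n)^2)) \<longlonglongrightarrow> 0"
      by (rule tendsto_eq_rhs, (rule tendsto_intros inv)+) simp
    show "\<forall>\<^sub>F n in sequentially. - ((2 * C - 4 * B) * (inverse (of_nat n) + inverse (of_nat n)^2) + 2 * A * (C - 2 * B) * inverse (of_nat n)^2) = p n / of_nat n ^ 2"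
      using ev0 by eventually_elim (simp add: p_def field_simps power2_eq_square)
  qed
  have q_lim: "(\<lambda>n. q n / of_nat n ^ 2) \<longlonglongrightarrow> 1"
  proof (rule Lim_transform_eventually)
    show "(\<lambda>n. 1 - inverse (of_nat n) - (C - 4 * A - 2) * inverse (of_nat n) + 2 * A * (2 * A + 1 - C) * inverse (of_nat n)^2) \<longlonglongrightarrow> 1"
      by (rule tendsto_eq_rhs, (rule tendsto_intros inv)+) simp
    show "\<forall>\<^sub>F n in sequentially. 1 - inverse (of_nat n) - (C - 4 * A - 2) * inverse (of_nat n) + 2 * A * (2 * A + 1 - C) * inverse (of_nat n)^2 = q n / of_nat n ^ 2"
      using ev0 by eventually_elim (simp add: q_def field_simps power2_eq_square)
  qed
  have d_nz: "\<forall>\<^sub>F n in sequentially. d n \<noteq> 0"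
    using tendsto_imp_eventually_ne[OF d_lim, of 0] by (auto elim: eventually_mono)
  have "(\<lambda>n. (p n / of_nat n ^ 2) / (d n / of_nat n ^ 2)) \<longlonglongrightarrow> 0"
    using tendsto_divide[OF p_lim d_lim] by simp
  moreover have "\<forall>\<^sub>F n in sequentially. (p n / of_nat n ^ 2) / (d n / of_nat n ^ 2) = p n / d n"
    using ev0 by eventually_elim simp
  ultimately have \<beta>: "(\<lambda>n. p n / d n) \<longlonglongrightarrow> 0"
    by (rule Lim_transform_eventually)
  have "(\<lambda>n. (q n / of_nat n ^ 2) / (d n / of_nat n ^ 2)) \<longlonglongrightarrow> 1"
    using tendsto_divide[OF q_lim d_lim] by simp
  moreover have "\<forall>\<^sub>F n in sequentially. (q n / of_nat n ^ 2) / (d n / of_nat n ^ 2) = q n / d n"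
    using ev0 by eventually_elim simp
  ultimately have \<gamma>: "(\<lambda>n. q n / d n) \<longlonglongrightarrow> 1"
    by (rule Lim_transform_eventually)
  have rec: "\<forall>\<^sub>F n in sequentially. fps_nth ?G (n + 2) = p n / d n * fps_nth ?G (n + 1) + q n / d n * fps_nth ?G n"
    using d_nz
  proof eventually_elim
    case (elim n)
    have "d n * fps_nth ?G (n + 2) = p n * fps_nth ?G (n + 1) + q n * fps_nth ?G n"
      unfolding d_def p_def q_def by (rule quadratic_rec)
    hence "fps_nth ?G (n + 2) = (p n * fps_nth ?G (n + 1) + q n * fps_nth ?G n) / d n"
      using elim by (metis nonzero_mult_div_cancel_left)
    thus ?case by (simp add: add_divide_distrib)
  qed
  show "\<exists>K. \<forall>n. norm (fps_nth ?G n) \<le> K * \<rho> ^ n"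
    using three_term_growth[OF rec \<beta> \<gamma> _ \<rho>] by auto
qed

section \<open>Analytic continuation\<close>

text \<open>\<open>W\<close> inverts \<open>w \<mapsto> 4 w / (1 + w)^2\<close> and maps the slit
  plane into the unit disc. The continuation is the transformed series, evaluated at
  \<open>W z\<close> and freed from its factor \<open>(1 + w)\<close> to the power
  \<open>-2*A\<close>.\<close>

lemma hyp2F1_reg_exists:
  obtains f where "f holomorphic_on slit_plane" "f has_fps_expansion hyp_fps A B C"
proof -
  define Z :: "complex fps" where "Z = 4 * fps_X * fps_binomial (-2)"
  define G where "G = fps_binomial (-2*A) * (hyp_fps A B C oo Z)"
  define W :: "complex \<Rightarrow> complex" where "W = (\<lambda>z. (1 - csqrt (1 - z)) / (1 + csqrt (1 - z)))"
  \<comment> \<open>The principal root has non-negative real part; a purely imaginary root would put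
    \<open>1 - z\<close> on the cut.\<close>
  have re: "Re (csqrt (1 - z)) > 0" if "z \<in> slit_plane" for z
  proof (rule ccontr)
    define s where "s = csqrt (1 - z)"
    assume "\<not> Re (csqrt (1 - z)) > 0"
    hence s0: "Re s = 0"
      using csqrt_principal[of "1 - z"] by (auto simp: s_def)
    have "1 - z = s ^ 2" by (simp add: s_def)
    hence "1 - z \<in> \<real>\<^sub>\<le>\<^sub>0"
      using s0 by (simp add: complex_nonpos_Reals_iff power2_eq_square)
    thus False using that by (simp add: slit_plane_iff)
  qed
  have nz: "1 + csqrt (1 - z) \<noteq> 0" if "z \<in> slit_plane" for z
    using re[OF that] by (auto simp: complex_eq_iff simp del: csqrt.simps)
  have W_hol: "W holomorphic_on slit_plane"
    unfolding W_def using nz by (intro holomorphic_intros) (auto simp: slit_plane_iff simp del: csqrt.simps)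
  have W_norm: "norm (W z) < 1" if "z \<in> slit_plane" for z
  proof -
    \<comment> \<open>The right half-plane consists of the points closer to 1 than to -1, so the
      Cayley transform \<open>W\<close> lands in the disc.\<close>
    have "(1 - Re (csqrt (1 - z)))\<^sup>2 < (1 + Re (csqrt (1 - z)))\<^sup>2"
      using re[OF that] by (simp add: power2_eq_square algebra_simps del: csqrt.simps)
    hence "norm (1 - csqrt (1 - z)) < norm (1 + csqrt (1 - z))"
      by (simp add: cmod_def del: csqrt.simps)
    thus ?thesis using nz[OF that] by (simp add: W_def norm_divide)
  qed
  have W1: "1 + W z \<noteq> 0" if "z \<in> slit_plane" for z
    using W_norm[OF that] by (metis add_eq_0_iff norm_minus_cancel norm_one order_less_irrefl)
  have W_eq: "4 * W z / (1 + W z) ^ 2 = z" if "z \<in> slit_plane" for z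
  proof -
    define s where "s = csqrt (1 - z)"
    have s2: "s * s = 1 - z" unfolding s_def by (metis power2_csqrt power2_eq_square)
    have s: "1 + s \<noteq> 0" using nz[OF that] by (simp add: s_def)
    have W: "W z = (1 - s) / (1 + s)" by (simp add: W_def s_def)
    have W': "1 + W z = 2 / (1 + s)" unfolding W using s by (simp add: field_simps)
    have "4 * W z / (1 + W z) ^ 2 = 4 * ((1 - s) / (1 + s)) / (2 / (1 + s)) ^ 2"
      unfolding W' unfolding W ..
    also have "\<dots> = (1 - s) * (1 + s)"
      using s by (simp add: power2_eq_square)
    finally have "4 * W z / (1 + W z) ^ 2 = (1 - s) * (1 + s)" .
    thus ?thesis using s2 by (simp add: algebra_simps)
  qed
  have W_fps: "W has_fps_expansion fps_expansion W 0"
    using W_hol open_slit_plane zero_in_slit_plane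
    by (intro analytic_at_imp_has_fps_expansion_0) (auto simp: analytic_at)
  have W0: "fps_nth (fps_expansion W 0) 0 = 0"
    using has_fps_expansion_imp_0_eq_fps_nth_0[OF W_fps] by (simp add: W_def)
  have ev: "\<forall>\<^sub>F z in nhds 0. z \<in> slit_plane"
    using open_slit_plane by (rule eventually_nhds_in_open) simp
  have Z0: "fps_nth Z 0 = 0" by (simp add: Z_def mult.assoc)
  have "(\<lambda>w. 4 * w * (1 + w) powr (-2)) has_fps_expansion Z"
    unfolding Z_def by (intro fps_expansion_intros)
  hence "((\<lambda>w. 4 * w * (1 + w) powr (-2)) \<circ> W) has_fps_expansion (Z oo fps_expansion W 0)"
    by (rule has_fps_expansion_compose[OF _ W_fps W0])
  moreover have "\<forall>\<^sub>F z in nhds 0. ((\<lambda>w. 4 * w * (1 + w) powr (-2)) \<circ> W) z = z"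
    using ev
  proof eventually_elim
    case (elim z)
    have "(1 + W z) powr (-2) = inverse ((1 + W z) ^ 2)"
      using W1[OF elim] powr_of_int[of "1 + W z" "-2"] by (simp add: powr_minus power_int_def)
    thus ?case using W_eq[OF elim] by (simp add: field_simps)
  qed
  ultimately have "(\<lambda>z. z) has_fps_expansion (Z oo fps_expansion W 0)"
    by (subst (asm) has_fps_expansion_cong[OF _ refl]) 
  \<comment> \<open>Formally \<open>W\<close> is the compositional inverse of \<open>Z\<close>;
    composing with it turns the series in \<open>Z\<close> back into the original one.\<close>
  hence ZW: "Z oo fps_expansion W 0 = fps_X"
    using fps_expansion_unique_complex has_fps_expansion_fps_X by blast
  have rad: "fps_conv_radius G \<ge> 1"
    unfolding G_def Z_def by (rule quadratic_conv_radius)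
  have "(\<lambda>w. (1 + w) powr (2*A) * eval_fps G w) has_fps_expansion fps_binomial (2*A) * G"
    using less_le_trans[OF ereal_0_less_1 rad] by (intro fps_expansion_intros eval_fps_has_fps_expansion)
  also have "fps_binomial (2*A) * G = hyp_fps A B C oo Z"
    unfolding G_def mult.assoc[symmetric] fps_binomial_add_mult[symmetric] by simp
  finally have "((\<lambda>w. (1 + w) powr (2*A) * eval_fps G w) \<circ> W) has_fps_expansion ((hyp_fps A B C oo Z) oo fps_expansion W 0)"
    by (rule has_fps_expansion_compose[OF _ W_fps W0])
  also have "(hyp_fps A B C oo Z) oo fps_expansion W 0 = hyp_fps A B C"
    using fps_compose_assoc[OF W0 Z0, of "hyp_fps A B C"] by (simp add: ZW)
  finally have *: "((\<lambda>w. (1 + w) powr (2*A) * eval_fps G w) \<circ> W) has_fps_expansion hyp_fps A B C" .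
  have "((\<lambda>w. (1 + w) powr (2*A) * eval_fps G w) \<circ> W) holomorphic_on slit_plane"
  proof (rule holomorphic_on_compose_gen[OF W_hol])
    show "(\<lambda>w. (1 + w) powr (2*A) * eval_fps G w) holomorphic_on ball 0 1"
    proof (intro holomorphic_intros)
      fix w :: complex assume w: "w \<in> ball 0 1"
      hence "\<bar>Re w\<bar> < 1" using abs_Re_le_cmod[of w] by simp
      thus "1 + w \<notin> \<real>\<^sub>\<le>\<^sub>0" by (auto simp: complex_nonpos_Reals_iff)
    next
      show "ball 0 1 \<subseteq> eball 0 (fps_conv_radius G)"
        using rad ball_eball_mono[of 1 "fps_conv_radius G" 0] by (simp add: one_ereal_def)
    qed
    show "W ` slit_plane \<subseteq> ball 0 1" using W_norm by auto
  qed
  with * that show ?thesis by blast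
qed

text \<open>The choice operator in \<open>hyp2F1_reg\<close> is discharged here; everything below
  uses only these two properties.\<close>

lemma hyp2F1_reg_spec:
  shows hyp2F1_reg_holomorphic: "hyp2F1_reg A B C holomorphic_on slit_plane"
    and hyp2F1_reg_fps: "hyp2F1_reg A B C has_fps_expansion hyp_fps A B C"
proof -
  obtain f where f: "f holomorphic_on slit_plane" "f has_fps_expansion hyp_fps A B C"
    by (rule hyp2F1_reg_exists)
  have "(\<lambda>n. fps_nth (hyp_fps A B C) n * z ^ n) sums f z" if "z \<in> ball 0 1" for z
    by (rule has_fps_expansion_imp_sums_complex[OF f(2), of 1])
       (use that f(1) unit_ball_subset_slit_plane in \<open>auto simp: one_ereal_def intro: holomorphic_on_subset\<close>)
  hence "\<exists>f. f holomorphic_on slit_plane \<and>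
        (\<forall>z\<in>ball 0 1.
           (\<lambda>k. pochhammer A k * pochhammer B k * rGamma (C + of_nat k) / fact k * z ^ k) sums f z)"
    using f(1) by (auto simp: hyp_fps_def)
  from someI_ex[OF this] have *: "hyp2F1_reg A B C holomorphic_on slit_plane"
    "\<And>z. z \<in> ball 0 1 \<Longrightarrow> (\<lambda>k. fps_nth (hyp_fps A B C) k * z ^ k) sums hyp2F1_reg A B C z"
    by (auto simp: hyp2F1_reg_def hyp_fps_def)
  show "hyp2F1_reg A B C holomorphic_on slit_plane" by fact
  have "\<forall>\<^sub>F z in nhds (0::complex). z \<in> ball 0 1"
    by (rule eventually_nhds_in_open) auto
  thus "hyp2F1_reg A B C has_fps_expansion hyp_fps A B C"
    by (intro has_fps_expansionI) (auto elim!: eventually_mono intro: *(2))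
qed

text \<open>The identity theorem, reducing linear relations on the slit plane to relations between
  coefficients.\<close>

lemma vanishing_fps_slit_plane:
  assumes "f has_fps_expansion 0" "f holomorphic_on slit_plane" "z \<in> slit_plane"
  shows "f z = 0"
  using has_fps_expansion_0_analytic_continuation[OF assms(1,2) open_slit_plane connected_slit_plane _ assms(3)]
  by simp

section \<open>Contiguous relations\<close>

lemma hyp_fps_nth: "fps_nth (hyp_fps A B C) k = pochhammer A k * pochhammer B k / fact k * rGamma (C + of_nat k)"
  by (simp add: hyp_fps_def)

text \<open>In degree \<open>k + 1\<close> all three terms share the factor
  \<open>A * B * P * q\<close>, and the relation becomes
  \<open>C + k = (C - 1) + (k + 1)\<close>.\<close>

lemma hyp2F1_reg_raise:
  assumes "z \<in> slit_plane"
  shows "hyp2F1_reg A B (C - 1) z = (C - 1) * hyp2F1_reg A B C z + A * B * (z * hyp2F1_reg (A + 1) (B + 1) (C + 1) z)"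
proof -
  let ?H = "hyp_fps A B (C - 1) - (fps_const (C - 1) * hyp_fps A B C + fps_const (A * B) * (fps_X * hyp_fps (A + 1) (B + 1) (C + 1)))"
  have "?H = 0"
  proof (rule fps_ext)
    fix n show "fps_nth ?H n = fps_nth 0 n"
    proof (cases n)
      case 0
      thus ?thesis using rGamma_plus1[of "C - 1"] by (simp add: hyp_fps_nth)
    next
      case (Suc k)
      define q where "q = rGamma (C + of_nat k + 1)"
      have q: "rGamma (C - 1 + of_nat (Suc k)) = (C + of_nat k) * q" "rGamma (C + of_nat (Suc k)) = q"
         "rGamma (C + 1 + of_nat k) = q"
        using rGamma_plus1[of "C + of_nat k"] by (simp_all add: q_def add_ac)
      define P where "P = pochhammer (A + 1) k * pochhammer (B + 1) k"
      have P: "pochhammer A (Suc k) * pochhammer B (Suc k) = A * B * P"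
        by (simp add: P_def pochhammer_rec)
      define m :: complex where "m = of_nat (Suc k)"
      have m: "m \<noteq> 0" "of_nat k = m - 1"
        unfolding m_def by (rule of_nat_neq_0) simp
      have f: "fact (Suc k) = m * fact k" by (simp add: m_def)
      have "fps_nth ?H n = A * B * P / (m * fact k) * ((C + of_nat k) * q)
          - ((C - 1) * (A * B * P / (m * fact k) * q) + A * B * (P / fact k * q))"
        unfolding Suc
        by (simp add: hyp_fps_nth q P f del: of_nat_Suc pochhammer_Suc fact_Suc) (simp add: P_def)
      thus ?thesis using m(1) by (simp add: m(2) field_simps)
    qed
  qed
  moreover have "(\<lambda>z. hyp2F1_reg A B (C - 1) z - ((C - 1) * hyp2F1_reg A B C z + A * B * (z * hyp2F1_reg (A + 1) (B + 1) (C + 1) z)))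
    has_fps_expansion ?H"
    by (intro fps_expansion_intros hyp2F1_reg_fps)
  ultimately show ?thesis
    using vanishing_fps_slit_plane[OF _ _ assms, of "\<lambda>z. hyp2F1_reg A B (C - 1) z - ((C - 1) * hyp2F1_reg A B C z + A * B * (z * hyp2F1_reg (A + 1) (B + 1) (C + 1) z))"]
    by (simp add: holomorphic_intros hyp2F1_reg_holomorphic)
qed

lemma hyp2F1_reg_contiguous:
  assumes "z \<in> slit_plane"
  shows "z * hyp2F1_reg A B (C - 1) z - hyp2F1_reg A B (C - 1) z + (C - 1) * hyp2F1_reg A B C z
     - (2 * C - A - B - 1) * (z * hyp2F1_reg A B C z) + (C - A) * (C - B) * (z * hyp2F1_reg A B (C + 1) z) = 0" (is "?h z = 0")
proof -
  let ?H = "fps_X * hyp_fps A B (C - 1) - hyp_fps A B (C - 1) + fps_const (C - 1) * hyp_fps A B C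
     - fps_const (2 * C - A - B - 1) * (fps_X * hyp_fps A B C) + fps_const ((C - A) * (C - B)) * (fps_X * hyp_fps A B (C + 1))"
  have "?H = 0"
  proof (rule fps_ext)
    fix n show "fps_nth ?H n = fps_nth 0 n"
    proof (cases n)
      case 0
      thus ?thesis using rGamma_plus1[of "C - 1"] by (simp add: hyp_fps_nth)
    next
      case (Suc k)
      \<comment> \<open>All reciprocal Gamma values are expressed by the one with the largest
        argument, and \<open>P'\<close> by \<open>P\<close> through the term ratio; the rest is a
        polynomial identity.\<close>
      define q where "q = rGamma (C + of_nat k + 1)"
      have q: "rGamma (C - 1 + of_nat k) = (C + of_nat k - 1) * ((C + of_nat k) * q)"
         "rGamma (C + of_nat k) = (C + of_nat k) * q"
         "rGamma (C - 1 + of_nat (Suc k)) = (C + of_nat k) * q" "rGamma (C + of_nat (Suc k)) = q"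
         "rGamma (C + 1 + of_nat k) = q"
        using rGamma_plus1[of "C + of_nat k"] rGamma_plus1[of "C + of_nat k - 1"] by (simp_all add: q_def algebra_simps)
      define P where "P = pochhammer A k * pochhammer B k / fact k"
      define P' where "P' = pochhammer A (Suc k) * pochhammer B (Suc k) / fact (Suc k)"
      define m :: complex where "m = of_nat k + 1"
      have "m \<noteq> 0" using of_nat_neq_0[of k, where 'a = complex] by (simp add: m_def add.commute)
      moreover have "fact (Suc k) = m * fact k" by (simp add: m_def add.commute)
      ultimately have "(of_nat k + 1) * P' = (A + of_nat k) * (B + of_nat k) * P"
        unfolding P_def P'_def pochhammer_Suc m_def[symmetric] by simp
      moreover have "fps_nth ?H n = P * ((C + of_nat k - 1) * ((C + of_nat k) * q)) - P' * ((C + of_nat k) * q)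
         + (C - 1) * (P' * q) - (2 * C - A - B - 1) * (P * ((C + of_nat k) * q)) + (C - A) * (C - B) * (P * q)"
        unfolding Suc by (simp add: hyp_fps_nth q P_def P'_def del: of_nat_Suc pochhammer_Suc fact_Suc)
      ultimately show ?thesis by simp algebra
    qed
  qed
  moreover have "?h has_fps_expansion ?H"
    by (intro fps_expansion_intros hyp2F1_reg_fps)
  ultimately show ?thesis
    using vanishing_fps_slit_plane[OF _ _ assms, of ?h]
    by (simp add: holomorphic_intros hyp2F1_reg_holomorphic)
qed

section \<open>The Pfaff substitution on coefficients\<close>

lemma fps_nth_binomial_compose:
  fixes F :: "complex fps"
  shows "fps_nth (fps_binomial (-q) * (F oo (fps_X * fps_binomial (-1)))) n =
    (\<Sum>k\<le>n. fps_nth F k * (-(q + of_nat k) gchoose (n - k)))"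
proof -
  let ?Z = "fps_X * fps_binomial (-1 :: complex)"
  have Zk: "?Z ^ k = fps_X ^ k * fps_binomial (- of_nat k)" for k
    by (simp add: power_mult_distrib fps_binomial_power)
  \<comment> \<open>The \<open>k\<close>-th power starts in degree \<open>k\<close>, so up to degree
    \<open>n\<close> the composition is a finite sum.\<close>
  have Z: "fps_nth (?Z ^ k) i = 0" if "i < k" for i k
    unfolding Zk using that by (simp add: fps_X_power_mult_nth)
  have "fps_nth (F oo ?Z) i = fps_nth (\<Sum>k\<le>n. fps_const (fps_nth F k) * ?Z ^ k) i" if "i \<le> n" for i
    unfolding fps_compose_nth fps_sum_nth fps_mult_left_const_nth
    using that by (intro sum.mono_neutral_left) (auto simp: Z)
  hence "fps_nth (fps_binomial (-q) * (F oo ?Z)) n = fps_nth (fps_binomial (-q) * (\<Sum>k\<le>n. fps_const (fps_nth F k) * ?Z ^ k)) n"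
    unfolding fps_mult_nth by (intro sum.cong) auto
  also have "fps_binomial (-q) * (\<Sum>k\<le>n. fps_const (fps_nth F k) * ?Z ^ k) =
     (\<Sum>k\<le>n. fps_const (fps_nth F k) * (fps_X ^ k * fps_binomial (-(q + of_nat k))))"
    unfolding sum_distrib_left Zk
    by (intro sum.cong refl) (simp add: fps_binomial_add_mult[of "-q", symmetric] mult.left_commute[of "fps_binomial (-q)"])
  also have "fps_nth \<dots> n = (\<Sum>k\<le>n. fps_nth F k * (-(q + of_nat k) gchoose (n - k)))"
    unfolding fps_sum_nth fps_mult_left_const_nth by (intro sum.cong) (auto simp: fps_X_power_mult_nth)
  finally show ?thesis .
qed

text \<open>The substitution is \<open>u = -t\<close>, under which
  \<open>u / (1 + u) = t / (t - 1)\<close>. The exponent \<open>q\<close> stays free: the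
  coefficient is then a terminating 3F2 sum, which is the shape of a continuous dual Hahn
  polynomial.\<close>

lemma hyp2F1_reg_pfaff_sums:
  assumes "norm t < 1"
  shows "(\<lambda>n. (\<Sum>k\<le>n. (-1) ^ k * fps_nth (hyp_fps A B C) k * pochhammer (q + of_nat k) (n - k) / fact (n - k)) * t ^ n)
     sums ((1 - t) powr (-q) * hyp2F1_reg A B C (t / (t - 1)))"
proof -
  define g where "g = (\<lambda>u. (1 + u) powr (-q) * hyp2F1_reg A B C (u * (1 + u) powr (-1)))"
  define G where "G = fps_binomial (-q) * (hyp_fps A B C oo (fps_X * fps_binomial (-1)))"
  have pow: "(1 + u) powr (-1) = 1 / (1 + u)" if "norm u < 1" for u :: complex
  proof -
    have "1 + u \<noteq> 0" using that by (metis add_eq_0_iff norm_minus_cancel norm_one order_less_irrefl)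
    thus ?thesis using powr_minus[of "1 + u" 1] by (simp add: divide_inverse)
  qed
  have "(hyp2F1_reg A B C \<circ> (\<lambda>u. u * (1 + u) powr (-1))) has_fps_expansion (hyp_fps A B C oo (fps_X * fps_binomial (-1)))"
    by (intro has_fps_expansion_compose hyp2F1_reg_fps fps_expansion_intros) simp
  hence g: "g has_fps_expansion G"
    unfolding g_def G_def o_def by (intro fps_expansion_intros)
  have nr: "1 + u \<notin> \<real>\<^sub>\<le>\<^sub>0" if "u \<in> ball 0 1" for u :: complex
  proof -
    have "\<bar>Re u\<bar> < 1" using that abs_Re_le_cmod[of u] by simp
    thus ?thesis by (auto simp: complex_nonpos_Reals_iff)
  qed
  have "(hyp2F1_reg A B C \<circ> (\<lambda>u. u * (1 + u) powr (-1))) holomorphic_on ball 0 1"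
  proof (rule holomorphic_on_compose_gen[OF _ hyp2F1_reg_holomorphic])
    show "(\<lambda>u::complex. u * (1 + u) powr (-1)) holomorphic_on ball 0 1"
      using nr by (intro holomorphic_intros)
    show "(\<lambda>u::complex. u * (1 + u) powr (-1)) ` ball 0 1 \<subseteq> slit_plane"
    proof safe
      fix u :: complex assume u: "u \<in> ball 0 1"
      have "1 + u \<noteq> 0" using nr[OF u] by auto
      \<comment> \<open>One minus the new argument is the reciprocal of \<open>1 + u\<close>, and
        inversion preserves the complement of the cut.\<close>
      hence "1 - u * (1 + u) powr (-1) = inverse (1 + u)"
        using pow[of u] u by (simp add: field_simps)
      thus "u * (1 + u) powr (-1) \<in> slit_plane"
        using nr[OF u] by (simp add: slit_plane_iff)
    qed
  qed
  hence "g holomorphic_on eball 0 1"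
    unfolding g_def o_def one_ereal_def eball_ereal using nr by (intro holomorphic_intros)
  hence "(\<lambda>n. fps_nth G n * (-t) ^ n) sums g (-t)"
    using assms by (intro has_fps_expansion_imp_sums_complex[OF g]) auto
  moreover have "g (-t) = (1 - t) powr (-q) * hyp2F1_reg A B C (t / (t - 1))"
  proof -
    have "t \<noteq> 1" using assms by auto
    hence *: "- t * (1 / (1 + - t)) = t / (t - 1)"
      by (simp add: field_simps)
    have "(1 + - t) powr (-1) = 1 / (1 + - t)"
      by (rule pow) (use assms in simp)
    with * show ?thesis unfolding g_def by simp
  qed
  moreover have "fps_nth G n * (-t) ^ n = (\<Sum>k\<le>n. (-1) ^ k * fps_nth (hyp_fps A B C) k * pochhammer (q + of_nat k) (n - k) / fact (n - k)) * t ^ n" for n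
  proof -
    have sgn: "(-1) ^ n * (-(q + of_nat k) gchoose (n - k)) = (-1) ^ k * pochhammer (q + of_nat k) (n - k) / fact (n - k)" if "k \<le> n" for k
    proof -
      have "(-1::complex) ^ n = (-1) ^ k * (-1) ^ (n - k)" using that by (simp flip: power_add)
      thus ?thesis by (simp add: gbinomial_pochhammer add.commute flip: power_mult_distrib)
    qed
    have "fps_nth G n * (-1) ^ n = (\<Sum>k\<le>n. (-1) ^ k * fps_nth (hyp_fps A B C) k * pochhammer (q + of_nat k) (n - k) / fact (n - k))"
      unfolding G_def fps_nth_binomial_compose sum_distrib_right
    proof (intro sum.cong refl)
      fix k assume "k \<in> {..n}"
      hence eq: "(-1) ^ n * (-(q + of_nat k) gchoose (n - k)) = (-1) ^ k * pochhammer (q + of_nat k) (n - k) / fact (n - k)"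
        by (intro sgn) simp
      have "fps_nth (hyp_fps A B C) k * (-(q + of_nat k) gchoose (n - k)) * (-1) ^ n
          = fps_nth (hyp_fps A B C) k * ((-1) ^ n * (-(q + of_nat k) gchoose (n - k)))"
        by (simp only: mult_ac)
      also have "\<dots> = (-1) ^ k * fps_nth (hyp_fps A B C) k * pochhammer (q + of_nat k) (n - k) / fact (n - k)"
        unfolding eq by simp
      finally show "fps_nth (hyp_fps A B C) k * (-(q + of_nat k) gchoose (n - k)) * (-1) ^ n
          = (-1) ^ k * fps_nth (hyp_fps A B C) k * pochhammer (q + of_nat k) (n - k) / fact (n - k)" .
    qed
    thus ?thesis by (simp add: power_minus[of t] mult_ac)
  qed
  ultimately show ?thesis by simp
qed

section \<open>Continuous dual Hahn polynomials\<close>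

lemma pochhammer_minus_Suc_shift:
  "(of_nat n + 1 - of_nat j) * pochhammer (- of_nat (Suc n)) j = (of_nat n + 1) * pochhammer (- of_nat n :: 'a::comm_ring_1) j"
proof -
  have "pochhammer (- of_nat (Suc n) :: 'a) (Suc j) = - of_nat (Suc n) * pochhammer (- of_nat n) j"
    by (simp add: pochhammer_rec)
  thus ?thesis by (simp add: pochhammer_Suc algebra_simps)
qed

text \<open>Here \<open>s\<close> stands for \<open>\<i> * csqrt y\<close>, so that
  \<open>s^2 = -y\<close>. The third parameter \<open>d\<close> is the one that gets
  shifted.\<close>

definition cdh :: "nat \<Rightarrow> complex \<Rightarrow> complex \<Rightarrow> complex \<Rightarrow> complex \<Rightarrow> complex" where
  "cdh n s a b d = (\<Sum>j\<le>n. pochhammer (- of_nat n) j / fact j * (pochhammer (a + s) j * pochhammer (a - s) j)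
     * (pochhammer (a + b + of_nat j) (n - j) * pochhammer (a + d + of_nat j) (n - j)))"

lemma cont_dual_hahn_eq_cdh: "cont_dual_hahn n y a b d = cdh n (\<i> * csqrt y) a b d"
  unfolding cont_dual_hahn_def cdh_def Let_def
  by (intro sum.cong) (auto simp: mult_ac)

lemma cdh_0 [simp]: "cdh 0 s a b d = 1"
  by (simp add: cdh_def)

text \<open>Termwise this is \<open>(x + 1)_(r+1) - (x)_(r+1) = (r + 1) * (x + 1)_r\<close>; the
  factor \<open>r + 1\<close> lowers the degree inside \<open>(-n)_j\<close>, and the top term
  \<open>j = n\<close> cancels.\<close>

lemma cdh_shift_diff:
  "cdh n s a b (d + 1) - cdh n s a b d = of_nat n * (a + b + of_nat n - 1) * cdh (n - 1) s a b (d + 1)"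
proof (cases n)
  case (Suc m)
  define \<phi> where "\<phi> = (\<lambda>j. pochhammer (a + s) j * pochhammer (a - s) j)"
  define L where "L = (\<lambda>j. pochhammer (- of_nat (Suc m)) j / fact j * \<phi> j * (pochhammer (a + b + of_nat j) (Suc m - j) * pochhammer (a + (d + 1) + of_nat j) (Suc m - j))
      - pochhammer (- of_nat (Suc m)) j / fact j * \<phi> j * (pochhammer (a + b + of_nat j) (Suc m - j) * pochhammer (a + d + of_nat j) (Suc m - j)))"
  define M where "M = (\<lambda>j. pochhammer (- of_nat m) j / fact j * \<phi> j * (pochhammer (a + b + of_nat j) (m - j) * pochhammer (a + (d + 1) + of_nat j) (m - j)))"
  have eq: "L j = (of_nat m + 1) * (a + b + of_nat m) * M j" if jm: "j \<le> m" for j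
  proof -
    obtain r where r: "m = j + r" using le_Suc_ex[OF jm] by blast
    define x where "x = a + d + of_nat j"
    define R where "R = pochhammer (x + 1) r"
    have x: "a + (d + 1) + of_nat j = x + 1" by (simp add: x_def)
    have 1: "pochhammer (a + (d + 1) + of_nat j) (Suc r) = R * (x + 1 + of_nat r)"
      unfolding x R_def by (rule pochhammer_Suc)
    have 2: "pochhammer (a + d + of_nat j) (Suc r) = x * R"
      unfolding x_def[symmetric] R_def by (rule pochhammer_rec)
    have 3: "pochhammer (a + (d + 1) + of_nat j) r = R"
      unfolding x R_def ..
    have 4: "pochhammer (a + b + of_nat j) (Suc r) = pochhammer (a + b + of_nat j) r * (a + b + of_nat m)"
      unfolding pochhammer_Suc by (simp add: r add.assoc)
    have 5: "(of_nat r + 1) * pochhammer (- of_nat (Suc m)) j = (of_nat m + 1) * pochhammer (- of_nat m :: complex) j"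
      using pochhammer_minus_Suc_shift[of m j, where 'a = complex] by (simp add: r algebra_simps)
    have s: "Suc m - j = Suc r" "m - j = r" by (auto simp: r)
    have alg: "p / f * g * (u * v * (R * (x + 1 + r'))) - p / f * g * (u * v * (x * R)) = ((r' + 1) * p) * (g / f * (u * v) * R)"
      for p f g u v r' :: complex
      by (simp add: divide_inverse algebra_simps)
    have "L j = ((of_nat r + 1) * pochhammer (- of_nat (Suc m)) j) * (\<phi> j / fact j * (pochhammer (a + b + of_nat j) r * (a + b + of_nat m)) * R)"
      unfolding L_def s 1 2 4 by (rule alg)
    also have "\<dots> = (of_nat m + 1) * (a + b + of_nat m) * M j" unfolding 5 M_def s 3 by simp
    finally show ?thesis .
  qed
  have "cdh n s a b (d + 1) - cdh n s a b d = (\<Sum>j\<le>Suc m. L j)"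
    unfolding Suc cdh_def L_def \<phi>_def sum_subtractf ..
  also have "\<dots> = (\<Sum>j\<le>m. L j)"
    by (simp add: L_def)
  also have "\<dots> = (of_nat m + 1) * (a + b + of_nat m) * cdh m s a b (d + 1)"
    unfolding cdh_def sum_distrib_left using eq by (intro sum.cong) (auto simp: M_def \<phi>_def)
  finally show ?thesis by (simp add: Suc algebra_simps)
qed simp

text \<open>Coefficients are compared in the basis \<open>\<phi> j\<close>. Since
  \<open>\<phi> (Suc j) = ((a + j)^2 - s^2) * \<phi> j\<close>, multiplication by
  \<open>e^2 - s^2\<close> acts on this basis by two terms with coefficients independent of
  \<open>s\<close>.\<close>

lemma cdh_Suc:
  "cdh (Suc n) s a b e = (e + a + of_nat n) * (e + b + of_nat n) * cdh n s a b e - (e ^ 2 - s ^ 2) * cdh n s a b (e + 1)"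
proof -
  define \<phi> where "\<phi> = (\<lambda>j. pochhammer (a + s) j * pochhammer (a - s) j)"
  define k where "k = (\<lambda>n j d. pochhammer (- of_nat n) j / fact j * (pochhammer (a + b + of_nat j) (n - j) * pochhammer (a + d + of_nat j) (n - j)))"
  \<comment> \<open>Allows every sum below to run up to \<open>Suc n\<close>.\<close>
  have k0: "k n j d = 0" if "j > n" for n j d
    using that by (simp add: k_def pochhammer_of_nat_eq_0_lemma)
  have cdh: "cdh n s a b d = (\<Sum>j\<le>n. k n j d * \<phi> j)" for n d
    unfolding cdh_def k_def \<phi>_def by (intro sum.cong) (auto simp: mult_ac)
  have cdh': "cdh n s a b d = (\<Sum>j\<le>Suc n. k n j d * \<phi> j)" for d
    by (simp add: cdh k0)
  have \<phi>: "(e ^ 2 - s ^ 2) * \<phi> j = \<phi> (Suc j) - ((a + of_nat j) ^ 2 - e ^ 2) * \<phi> j" for j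
    by (simp add: \<phi>_def pochhammer_Suc power2_eq_square algebra_simps)
  \<comment> \<open>The coefficient identity. The ends \<open>j = 0\<close> and
    \<open>j = Suc n\<close> are separate because there one of the neighbouring coefficients is
    missing; in the interior all terms are multiples of one product
    \<open>q * U * V\<close>.\<close>
  have rec: "k (Suc n) j e = (e + a + of_nat n) * (e + b + of_nat n) * k n j e
      - (if j = 0 then 0 else k n (j - 1) (e + 1)) + ((a + of_nat j) ^ 2 - e ^ 2) * k n j (e + 1)" if jn: "j \<le> Suc n" for j
  proof -
    consider "j = 0" | "j = Suc n" | i r where "j = Suc i" "n = Suc (i + r)"
    proof (cases j)
      case (Suc i)
      show ?thesis
      proof (cases "j = Suc n")
        case False
        with jn Suc have "n = Suc (i + (n - Suc i))" by auto
        with Suc that(3) show ?thesis by blast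
      qed (use that(2) in auto)
    qed (use that(1) in auto)
    thus ?thesis
    proof cases
      case 1
      define U where "U = pochhammer (a + b) n"
      define V where "V = pochhammer (a + e) (Suc n)"
      define W where "W = pochhammer (a + e) n"
      define Y where "Y = pochhammer (a + (e + 1)) n"
      have V1: "V = (a + e) * Y"
        unfolding V_def Y_def by (simp add: pochhammer_rec add_ac)
      have V2: "V = W * (a + e + of_nat n)"
        unfolding V_def W_def by (simp add: pochhammer_Suc)
      have U1: "pochhammer (a + b) (Suc n) = U * (a + b + of_nat n)"
        unfolding U_def by (simp add: pochhammer_Suc)
      have t1: "(e + a + of_nat n) * (e + b + of_nat n) * (U * W) = (e + b + of_nat n) * U * V"
        unfolding V2 by (simp only: mult_ac add_ac)
      have t2: "(a ^ 2 - e ^ 2) * (U * Y) = (a - e) * U * V"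
        unfolding V1 by (simp add: power2_eq_square algebra_simps)
      have t3: "U * (a + b + of_nat n) * V = (e + b + of_nat n) * U * V + (a - e) * U * V"
        by (simp add: algebra_simps)
      have "k (Suc n) 0 e = U * (a + b + of_nat n) * V" "k n 0 e = U * W" "k n 0 (e + 1) = U * Y"
        using U1 by (simp_all add: k_def V_def W_def U_def Y_def)
      thus ?thesis by (simp only: 1 t1 t2 t3 if_True of_nat_0 add_0_right diff_0_right simp_thms)
    next
      case 2
      have "pochhammer (- of_nat (Suc n)) (Suc n) = - of_nat (Suc n) * pochhammer (- of_nat n :: complex) n"
        by (simp add: pochhammer_rec)
      hence "k (Suc n) (Suc n) e = - k n n (e + 1)"
        by (simp add: k_def field_simps del: of_nat_Suc)
      thus ?thesis by (simp add: 2 k0)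
    next
      case 3
      define U where "U = pochhammer (a + b + of_nat j) r"
      define V where "V = pochhammer (a + e + of_nat j) (Suc r)"
      have V1: "V = (a + e + of_nat j) * pochhammer (a + (e + 1) + of_nat j) r"
        unfolding V_def by (simp add: pochhammer_rec add_ac)
      have V2: "V = pochhammer (a + e + of_nat j) r * (a + e + of_nat n)"
        unfolding V_def by (simp add: pochhammer_Suc 3 add_ac)
      have V3: "pochhammer (a + (e + 1) + of_nat i) (Suc r) = V"
        by (simp add: V_def 3 add_ac)
      have U1: "pochhammer (a + b + of_nat j) (Suc r) = U * (a + b + of_nat n)"
        unfolding U_def by (simp add: pochhammer_Suc 3 add_ac)
      have U2: "pochhammer (a + b + of_nat i) (Suc r) = (a + b + of_nat i) * U"
        unfolding U_def by (simp add: pochhammer_rec 3 add_ac)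
      define q :: complex where "q = pochhammer (- of_nat n) i / fact j"
      have j0: "of_nat j \<noteq> (0::complex)" unfolding 3 by (rule of_nat_neq_0)
      have q1: "pochhammer (- of_nat (Suc n)) j / fact j = - (of_nat n + 1) * q"
        unfolding q_def 3(1) by (simp add: pochhammer_rec algebra_simps)
      have q2: "pochhammer (- of_nat n) j / fact j = (of_nat i - of_nat n) * q"
        unfolding q_def 3(1) by (simp add: pochhammer_Suc algebra_simps)
      have q3: "pochhammer (- of_nat n) i / fact i = of_nat j * q"
        unfolding q_def using j0 by (simp add: 3(1) fact_Suc del: of_nat_Suc)
      have d: "Suc n - j = Suc r" "n - j = r" "n - i = Suc r" "j - 1 = i" "j \<noteq> 0" by (auto simp: 3)
      have ji: "of_nat j = of_nat i + (1::complex)" by (simp add: 3)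
      define W where "W = pochhammer (a + e + of_nat j) r"
      define Y where "Y = pochhammer (a + (e + 1) + of_nat j) r"
      have t1: "(e + a + of_nat n) * (e + b + of_nat n) * ((of_nat i - of_nat n) * q * (U * W))
           = (e + b + of_nat n) * (of_nat i - of_nat n) * q * U * V"
        unfolding V2 W_def[symmetric] by (simp only: mult_ac add_ac)
      have t2: "((a + of_nat j) ^ 2 - e ^ 2) * ((of_nat i - of_nat n) * q * (U * Y))
          = (a + of_nat j - e) * (of_nat i - of_nat n) * q * U * V"
        unfolding V1 Y_def[symmetric] by (simp add: power2_eq_square algebra_simps)
      have t3: "- (of_nat n + 1) * q * (U * (a + b + of_nat n) * V) = (e + b + of_nat n) * (of_nat i - of_nat n) * q * U * V
          - of_nat j * q * ((a + b + of_nat i) * U * V) + (a + of_nat j - e) * (of_nat i - of_nat n) * q * U * V"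
        unfolding ji by (simp add: algebra_simps)
      show ?thesis unfolding k_def d q1 q2 q3 U1 U2 V3 V_def[symmetric] U_def[symmetric] W_def[symmetric] Y_def[symmetric] t1 t2
        by (simp only: t3 d(5) if_False)
    qed
  qed
  have "(e ^ 2 - s ^ 2) * cdh n s a b (e + 1) = (\<Sum>j\<le>n. k n j (e + 1) * \<phi> (Suc j)) - (\<Sum>j\<le>n. ((a + of_nat j) ^ 2 - e ^ 2) * k n j (e + 1) * \<phi> j)"
    unfolding cdh sum_distrib_left sum_subtractf[symmetric]
  proof (intro sum.cong refl)
    fix j
    show "(e ^ 2 - s ^ 2) * (k n j (e + 1) * \<phi> j) = k n j (e + 1) * \<phi> (Suc j) - ((a + of_nat j) ^ 2 - e ^ 2) * k n j (e + 1) * \<phi> j"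
      using arg_cong[OF \<phi>[of j], of "\<lambda>x. k n j (e + 1) * x"] by (simp add: algebra_simps)
  qed
  also have "(\<Sum>j\<le>n. k n j (e + 1) * \<phi> (Suc j)) = (\<Sum>j\<le>Suc n. (if j = 0 then 0 else k n (j - 1) (e + 1)) * \<phi> j)"
    by (subst sum.atMost_Suc_shift) simp
  also have "(\<Sum>j\<le>n. ((a + of_nat j) ^ 2 - e ^ 2) * k n j (e + 1) * \<phi> j) = (\<Sum>j\<le>Suc n. ((a + of_nat j) ^ 2 - e ^ 2) * k n j (e + 1) * \<phi> j)"
    by (simp add: k0)
  finally have e1: "(e ^ 2 - s ^ 2) * cdh n s a b (e + 1) = (\<Sum>j\<le>Suc n. (if j = 0 then 0 else k n (j - 1) (e + 1)) * \<phi> j)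
     - (\<Sum>j\<le>Suc n. ((a + of_nat j) ^ 2 - e ^ 2) * k n j (e + 1) * \<phi> j)" .
  have "cdh (Suc n) s a b e = (\<Sum>j\<le>Suc n. (e + a + of_nat n) * (e + b + of_nat n) * (k n j e * \<phi> j)
      - (if j = 0 then 0 else k n (j - 1) (e + 1)) * \<phi> j + ((a + of_nat j) ^ 2 - e ^ 2) * k n j (e + 1) * \<phi> j)"
    unfolding cdh
  proof (intro sum.cong refl)
    fix j assume "j \<in> {..Suc n}"
    hence "j \<le> Suc n" by simp
    show "k (Suc n) j e * \<phi> j = (e + a + of_nat n) * (e + b + of_nat n) * (k n j e * \<phi> j)
      - (if j = 0 then 0 else k n (j - 1) (e + 1)) * \<phi> j + ((a + of_nat j) ^ 2 - e ^ 2) * k n j (e + 1) * \<phi> j"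
      unfolding rec[OF \<open>j \<le> Suc n\<close>] by (simp only: distrib_right left_diff_distrib mult.assoc)
  qed
  also have "\<dots> = (e + a + of_nat n) * (e + b + of_nat n) * cdh n s a b e - (e ^ 2 - s ^ 2) * cdh n s a b (e + 1)"
    unfolding e1 cdh'[of e] by (simp only: sum.distrib sum_subtractf sum_distrib_left) simp
  finally show ?thesis .
qed

text \<open>The recursion of \<open>cdh_Suc\<close> with the shifted parameter in the first slot.
  Now the basis itself moves:
  \<open>\<psi> e (Suc j) = (e^2 - s^2) * \<psi> (e + 1) j\<close>.\<close>

lemma cdh_Suc_swapped:
  "cdh (Suc n) s e b a = (e + a + of_nat n) * (e + b + of_nat n) * cdh n s e b a - (e ^ 2 - s ^ 2) * cdh n s (e + 1) b a"
proof -
  define \<psi> where "\<psi> = (\<lambda>e j. pochhammer (e + s) j * pochhammer (e - s) j)"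
  define Q where "Q = (\<lambda>j. pochhammer (e + b + of_nat j) (Suc n - j) * pochhammer (e + a + of_nat j) (Suc n - j))"
  \<comment> \<open>The two factors complete both Pochhammer symbols to the length they have in
    degree \<open>Suc n\<close>, so that the degrees differ only in \<open>(-n)_j\<close>.\<close>
  have 1: "(e + a + of_nat n) * (e + b + of_nat n) * cdh n s e b a = (\<Sum>j\<le>Suc n. pochhammer (- of_nat n) j / fact j * \<psi> e j * Q j)"
  proof -
    have *: "pochhammer (x + of_nat j) (Suc n - j) = pochhammer (x + of_nat j) (n - j) * (x + of_nat n)" if "j \<le> n" for j and x :: complex
      using that by (simp add: Suc_diff_le pochhammer_Suc of_nat_diff)
    have "(e + a + of_nat n) * (e + b + of_nat n) * cdh n s e b a = (\<Sum>j\<le>n. pochhammer (- of_nat n) j / fact j * \<psi> e j * Q j)"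
      unfolding cdh_def sum_distrib_left by (intro sum.cong refl) (simp add: Q_def \<psi>_def *)
    thus ?thesis by (simp add: pochhammer_of_nat_eq_0_lemma)
  qed
  have "cdh (Suc n) s e b a - (e + a + of_nat n) * (e + b + of_nat n) * cdh n s e b a =
     (\<Sum>j\<le>Suc n. (pochhammer (- of_nat (Suc n)) j - pochhammer (- of_nat n) j) / fact j * \<psi> e j * Q j)"
    unfolding 1 unfolding cdh_def sum_subtractf[symmetric]
    by (intro sum.cong refl) (simp add: Q_def \<psi>_def algebra_simps diff_divide_distrib)
  also have "\<dots> = (\<Sum>j\<le>n. (pochhammer (- of_nat (Suc n)) (Suc j) - pochhammer (- of_nat n) (Suc j)) / fact (Suc j) * \<psi> e (Suc j) * Q (Suc j))"
    by (subst sum.atMost_Suc_shift) simp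
  also have "\<dots> = (\<Sum>j\<le>n. - (e ^ 2 - s ^ 2) * (pochhammer (- of_nat n) j / fact j * \<psi> (e + 1) j * 
       (pochhammer (e + 1 + b + of_nat j) (n - j) * pochhammer (e + 1 + a + of_nat j) (n - j))))"
  proof (intro sum.cong refl)
    fix j
    have p: "pochhammer (- of_nat (Suc n)) (Suc j) - pochhammer (- of_nat n :: complex) (Suc j) = - of_nat (Suc j) * pochhammer (- of_nat n) j"
      by (subst pochhammer_rec) (simp add: pochhammer_Suc algebra_simps)
    have "(pochhammer (- of_nat (Suc n)) (Suc j) - pochhammer (- of_nat n :: complex) (Suc j)) / fact (Suc j) = - (pochhammer (- of_nat n) j / fact j)"
      unfolding p fact_Suc of_nat_mult using of_nat_neq_0[of j, where 'a = complex] by (simp del: of_nat_Suc)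
    moreover have "\<psi> e (Suc j) = (e ^ 2 - s ^ 2) * \<psi> (e + 1) j"
      unfolding \<psi>_def by (simp add: pochhammer_rec power2_eq_square algebra_simps)
    moreover have "Q (Suc j) = pochhammer (e + 1 + b + of_nat j) (n - j) * pochhammer (e + 1 + a + of_nat j) (n - j)"
      unfolding Q_def by (simp add: add_ac)
    ultimately show "(pochhammer (- of_nat (Suc n)) (Suc j) - pochhammer (- of_nat n) (Suc j)) / fact (Suc j) * \<psi> e (Suc j) * Q (Suc j)
      = - (e ^ 2 - s ^ 2) * (pochhammer (- of_nat n) j / fact j * \<psi> (e + 1) j * 
       (pochhammer (e + 1 + b + of_nat j) (n - j) * pochhammer (e + 1 + a + of_nat j) (n - j)))"
      by (simp only: mult_minus_left mult_minus_right mult_ac)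
  qed
  also have "\<dots> = - (e ^ 2 - s ^ 2) * cdh n s (e + 1) b a"
    unfolding cdh_def sum_distrib_left \<psi>_def ..
  finally show ?thesis by (simp add: algebra_simps)
qed

text \<open>Both orders satisfy the same recursion in the degree and start at 1. The recursion
  shifts \<open>d\<close>, hence the induction is over all \<open>d\<close>.\<close>

lemma cdh_swap: "cdh n s d b a = cdh n s a b d"
proof (induction n arbitrary: d)
  case (Suc n)
  show ?case by (simp only: cdh_Suc_swapped[of n s d b a] cdh_Suc[of n s a b d] Suc)
qed simp

text \<open>The Pfaff expansion with \<open>q = b + d\<close> produces the polynomials with
  \<open>d\<close> in the first slot; symmetry moves it to the third.\<close>

lemma cdh_generating_function:
  assumes "norm t < 1"
  shows "(\<lambda>n. rGamma (of_nat n + 1) * rGamma (of_nat n + (a + d)) * cdh n s a b d * t ^ n)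
     sums ((1 - t) powr (- (b + d)) * hyp2F1_reg (d + s) (d - s) (a + d) (t / (t - 1)))"
proof -
  have "(\<Sum>k\<le>n. (-1) ^ k * fps_nth (hyp_fps (d + s) (d - s) (a + d)) k * pochhammer (b + d + of_nat k) (n - k) / fact (n - k))
     = rGamma (of_nat n + 1) * rGamma (of_nat n + (a + d)) * cdh n s a b d" for n
  proof -
    have *: "(-1) ^ k * fps_nth (hyp_fps (d + s) (d - s) (a + d)) k * pochhammer (b + d + of_nat k) (n - k) / fact (n - k) =
       rGamma (of_nat n + 1) * rGamma (of_nat n + (a + d)) *
       (pochhammer (- of_nat n) k / fact k * (pochhammer (d + s) k * pochhammer (d - s) k) *
        (pochhammer (d + b + of_nat k) (n - k) * pochhammer (d + a + of_nat k) (n - k)))" if k: "k \<le> n" for k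
    proof -
    have g: "rGamma (of_nat n + 1 :: complex) = 1 / fact n"
      using Gamma_fact[of n, where 'a = complex] by (simp add: rGamma_inverse_Gamma divide_inverse add.commute)
    \<comment> \<open>This turns the reciprocal Gamma factor of index \<open>k\<close> into the
      second Pochhammer symbol of the polynomial, without dividing by a possibly vanishing
      quantity.\<close>
    have "rGamma (a + d + of_nat k) = pochhammer (a + d + of_nat k) (n - k) * rGamma (a + d + of_nat k + of_nat (n - k))"
      by (rule pochhammer_rGamma)
    hence r: "rGamma (a + d + of_nat k) = pochhammer (d + a + of_nat k) (n - k) * rGamma (of_nat n + (a + d))"
      using k by (simp add: of_nat_diff add_ac)
    have "(of_nat n gchoose k :: complex) = of_nat (n choose k)"
      by (simp add: binomial_gbinomial)
    hence "(-1) ^ k * pochhammer (- of_nat n :: complex) k / fact k = fact n / (fact k * fact (n - k))"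
      by (simp add: gbinomial_pochhammer binomial_fact[OF k])
    hence "(-1) ^ k * ((-1) ^ k * pochhammer (- of_nat n :: complex) k / fact k) = (-1) ^ k * (fact n / (fact k * fact (n - k)))"
      by (rule arg_cong)
    hence p: "pochhammer (- of_nat n :: complex) k / fact k = (-1) ^ k * (fact n / (fact k * fact (n - k)))"
      by (simp flip: power_mult_distrib mult.assoc)
      show ?thesis unfolding p g hyp_fps_nth r by (simp add: add_ac)
    qed
    have "(\<Sum>k\<le>n. (-1) ^ k * fps_nth (hyp_fps (d + s) (d - s) (a + d)) k * pochhammer (b + d + of_nat k) (n - k) / fact (n - k))
      = rGamma (of_nat n + 1) * rGamma (of_nat n + (a + d)) * cdh n s d b a"
      unfolding cdh_def sum_distrib_left by (intro sum.cong refl *) simp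
    thus ?thesis by (simp only: cdh_swap)
  qed
  thus ?thesis
    using hyp2F1_reg_pfaff_sums[OF assms, of "d + s" "d - s" "a + d" "b + d"] by simp
qed

section \<open>Meixner polynomials\<close>

text \<open>A real argument keeps \<open>x - 1\<close> meaningful at \<open>x = 0\<close>;
  \<open>w\<close> stands for \<open>1 - 1 / c\<close>.\<close>

definition meixner_poly :: "nat \<Rightarrow> real \<Rightarrow> real \<Rightarrow> real \<Rightarrow> real" where
  "meixner_poly n x \<beta> w = (\<Sum>k\<le>n. pochhammer (- real n) k * pochhammer (- x) k / (pochhammer \<beta> k * fact k) * w ^ k)"

lemma meixner_eq_poly: "meixner n x \<beta> c = meixner_poly n (real x) \<beta> (1 - 1 / c)"
  by (simp add: meixner_def meixner_poly_def atMost_atLeast0)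

text \<open>On the basis \<open>(-x)_k\<close> the operator \<open>(x + \<beta>)\<close> times the
  forward difference involves only the indices \<open>k\<close> and \<open>k - 1\<close>, which is
  what makes the sums below telescope.\<close>

lemma pochhammer_forward_difference:
  "(x + \<beta>) * (pochhammer (- (x + 1)) k - pochhammer (- x) k) =
     - of_nat k * ((\<beta> + of_nat k - 1) * pochhammer (- x) (k - 1) - pochhammer (- x) k)" for x :: "'a::comm_ring_1"
proof (cases k)
  case (Suc i)
  have 1: "pochhammer (- (x + 1)) (Suc i) = - (x + 1) * pochhammer (- x) i"
    by (subst pochhammer_rec) simp
  have 2: "pochhammer (- x) (Suc i) = pochhammer (- x) i * (- x + of_nat i)"
    by (rule pochhammer_Suc)
  show ?thesis unfolding Suc 1 2 by (simp add: algebra_simps)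
qed simp

lemma pochhammer_backward_difference:
  "x * (pochhammer (- x) k - pochhammer (- (x - 1)) k) = of_nat k * pochhammer (- x) k" for x :: "'a::comm_ring_1"
proof (cases k)
  case (Suc i)
  have 1: "pochhammer (- x) (Suc i) = - x * pochhammer (- (x - 1)) i"
    by (subst pochhammer_rec) simp
  have 2: "pochhammer (- (x - 1)) (Suc i) = pochhammer (- (x - 1)) i * (- (x - 1) + of_nat i)"
    by (rule pochhammer_Suc)
  show ?thesis unfolding Suc 1 2 by (simp add: algebra_simps)
qed simp

lemma meixner_poly_difference_equation:
  assumes \<beta>: "\<beta> > 0"
  shows "(x + \<beta>) * (meixner_poly n (x + 1) \<beta> w - meixner_poly n x \<beta> w) =
     real n * w * meixner_poly n x \<beta> w + (1 - w) * (x * (meixner_poly n x \<beta> w - meixner_poly n (x - 1) \<beta> w))"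
proof -
  define v where "v = (\<lambda>k. pochhammer (- real n) k / (pochhammer \<beta> k * fact k) * w ^ k)"
  \<comment> \<open>Telescoping certificate: it vanishes at 0 by the factor \<open>real k\<close>
    and at \<open>Suc n\<close> because \<open>(-n)_(n+1) = 0\<close>.\<close>
  define H where "H = (\<lambda>k. real k * (\<beta> + real k - 1) * v k * pochhammer (- x) (k - 1))"
  have M: "meixner_poly n X \<beta> w = (\<Sum>k\<le>n. v k * pochhammer (- X) k)" for X
    unfolding meixner_poly_def v_def by (intro sum.cong) auto
  have v: "(real k + 1) * (\<beta> + real k) * v (Suc k) = (real k - real n) * w * v k" for k
  proof -
    define B where "B = \<beta> + real k"
    define K where "K = real k + 1"
    have nz: "B \<noteq> 0" "K \<noteq> 0" "pochhammer \<beta> k \<noteq> 0"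
      using \<beta> pochhammer_pos[OF \<beta>, of k] by (simp_all add: B_def K_def)
    have f: "fact (Suc k) = K * (fact k :: real)" by (simp add: K_def)
    show ?thesis unfolding v_def pochhammer_Suc f B_def[symmetric] K_def[symmetric]
      using nz by (simp add: field_simps)
  qed
  have "(x + \<beta>) * (meixner_poly n (x + 1) \<beta> w - meixner_poly n x \<beta> w) -
     (real n * w * meixner_poly n x \<beta> w + (1 - w) * (x * (meixner_poly n x \<beta> w - meixner_poly n (x - 1) \<beta> w)))
     = (\<Sum>k\<le>n. v k * ((x + \<beta>) * (pochhammer (- (x + 1)) k - pochhammer (- x) k))
         - (real n * w * (v k * pochhammer (- x) k) + (1 - w) * (v k * (x * (pochhammer (- x) k - pochhammer (- (x - 1)) k)))))"
    unfolding M sum_subtractf[symmetric] sum_distrib_left sum.distrib[symmetric]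
    by (intro sum.cong refl) (simp only: algebra_simps)
  also have "\<dots> = (\<Sum>k\<le>n. H (Suc k) - H k)"
  proof (intro sum.cong refl)
    fix k
    have "H (Suc k) = (real k + 1) * (\<beta> + real k) * v (Suc k) * pochhammer (- x) k"
      by (simp add: H_def algebra_simps)
    also have "\<dots> = (real k - real n) * w * v k * pochhammer (- x) k"
      unfolding v ..
    finally have H: "H (Suc k) = (real k - real n) * w * v k * pochhammer (- x) k" .
    show "v k * ((x + \<beta>) * (pochhammer (- (x + 1)) k - pochhammer (- x) k))
         - (real n * w * (v k * pochhammer (- x) k) + (1 - w) * (v k * (x * (pochhammer (- x) k - pochhammer (- (x - 1)) k))))
       = H (Suc k) - H k"
      unfolding H pochhammer_forward_difference pochhammer_backward_difference
      by (simp add: H_def algebra_simps)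
  qed
  also have "\<dots> = H (Suc n) - H 0"
    using sum_lessThan_telescope[of H "Suc n"] by (simp add: lessThan_Suc_atMost)
  also have "\<dots> = 0"
    by (simp add: H_def v_def pochhammer_of_nat_eq_0_lemma)
  finally show ?thesis by simp
qed

text \<open>The series is symmetric in degree and variable, so a forward step in either one acts by
  \<open>pochhammer_forward_difference\<close>; the difference of the two steps telescopes up to a
  multiple of the polynomial itself.\<close>

lemma meixner_poly_mixed:
  assumes \<beta>: "\<beta> > 0"
  shows "(real n + \<beta>) * (meixner_poly (Suc n) x \<beta> w - meixner_poly n x \<beta> w) + (real n - x) * w * meixner_poly n x \<beta> w
     = (x + \<beta>) * (meixner_poly n (x + 1) \<beta> w - meixner_poly n x \<beta> w)"
proof -
  define v where "v = (\<lambda>k. w ^ k / (pochhammer \<beta> k * fact k))"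
  define P where "P = (\<lambda>x k. pochhammer (- x :: real) k)"
  define H where "H = (\<lambda>k. (x - real n) * (real k * (\<beta> + real k - 1) * v k) * P x (k - 1) * P (real n) (k - 1))"
  have M': "meixner_poly (Suc n) X \<beta> w = (\<Sum>k\<le>Suc n. v k * P X k * P (real n + 1) k)" for X
    unfolding meixner_poly_def v_def P_def by (intro sum.cong) (auto simp: add_ac)
  have "meixner_poly n X \<beta> w = (\<Sum>k\<le>n. v k * P X k * P (real n) k)" for X
    unfolding meixner_poly_def v_def P_def by (intro sum.cong) auto
  \<comment> \<open>Padded by a zero term to match the longer sum of degree
    \<open>Suc n\<close>.\<close>
  hence M: "meixner_poly n X \<beta> w = (\<Sum>k\<le>Suc n. v k * P X k * P (real n) k)" for X
    by (simp add: P_def pochhammer_of_nat_eq_0_lemma)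
  have v: "(real k + 1) * (\<beta> + real k) * v (Suc k) = w * v k" for k
  proof -
    define B where "B = \<beta> + real k"
    define K where "K = real k + 1"
    have nz: "B \<noteq> 0" "K \<noteq> 0" "pochhammer \<beta> k \<noteq> 0"
      using \<beta> pochhammer_pos[OF \<beta>, of k] by (simp_all add: B_def K_def)
    have f: "fact (Suc k) = K * (fact k :: real)" by (simp add: K_def)
    show ?thesis unfolding v_def pochhammer_Suc f B_def[symmetric] K_def[symmetric]
      using nz by (simp add: field_simps)
  qed
  have "(real n + \<beta>) * (meixner_poly (Suc n) x \<beta> w - meixner_poly n x \<beta> w) + (real n - x) * w * meixner_poly n x \<beta> w
     - (x + \<beta>) * (meixner_poly n (x + 1) \<beta> w - meixner_poly n x \<beta> w)
     = (\<Sum>k\<le>Suc n. v k * P x k * ((real n + \<beta>) * (P (real n + 1) k - P (real n) k)) + (real n - x) * w * (v k * P x k * P (real n) k)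
         - v k * P (real n) k * ((x + \<beta>) * (P (x + 1) k - P x k)))"
    unfolding M M' sum_subtractf[symmetric] sum_distrib_left sum.distrib[symmetric]
    by (intro sum.cong refl) (simp only: algebra_simps)
  also have "\<dots> = (\<Sum>k\<le>Suc n. H k - H (Suc k))"
  proof (intro sum.cong refl)
    fix k
    have "H (Suc k) = (x - real n) * ((real k + 1) * (\<beta> + real k) * v (Suc k)) * P x k * P (real n) k"
      by (simp add: H_def algebra_simps)
    hence H: "H (Suc k) = (x - real n) * (w * v k) * P x k * P (real n) k"
      unfolding v .
    have "real k * (P x (k - 1) * P (real n) k - P x k * P (real n) (k - 1)) = real k * (x - real n) * (P x (k - 1) * P (real n) (k - 1))"
      by (cases k) (simp_all add: P_def pochhammer_Suc algebra_simps)
    hence H': "H k = (\<beta> + real k - 1) * v k * (real k * (P x (k - 1) * P (real n) k - P x k * P (real n) (k - 1)))"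
      by (auto simp: H_def)
    show "v k * P x k * ((real n + \<beta>) * (P (real n + 1) k - P (real n) k)) + (real n - x) * w * (v k * P x k * P (real n) k)
         - v k * P (real n) k * ((x + \<beta>) * (P (x + 1) k - P x k)) = H k - H (Suc k)"
      unfolding H H' P_def pochhammer_forward_difference
      by (simp add: algebra_simps)
  qed
  also have "\<dots> = - (\<Sum>k\<le>Suc n. H (Suc k) - H k)"
    unfolding sum_negf[symmetric] by simp
  also have "\<dots> = - (H (Suc (Suc n)) - H 0)"
    using sum_lessThan_telescope[of H "Suc (Suc n)"] by (simp only: lessThan_Suc_atMost)
  also have "\<dots> = 0"
    by (simp add: H_def P_def pochhammer_of_nat_eq_0_lemma)
  finally show ?thesis by simp
qed

text \<open>The normalisation makes both contiguous relations division free.\<close>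

definition meixner_n :: "nat \<Rightarrow> nat \<Rightarrow> real \<Rightarrow> real \<Rightarrow> real" where
  "meixner_n n x \<beta> c = (- c) ^ x * pochhammer \<beta> x * meixner n x \<beta> c"

lemma meixner_n_0 [simp]: "meixner_n n 0 \<beta> c = 1"
proof -
  have "meixner n 0 \<beta> c = (\<Sum>k=0..n. if k = 0 then 1 else 0)"
    unfolding meixner_def by (intro sum.cong) (auto simp: pochhammer_0_left)
  thus ?thesis by (simp add: meixner_n_def)
qed

lemma meixner_n_rec_x:
  assumes "\<beta> > 0" "c > 0"
  shows "meixner_n n (Suc x) \<beta> c = (real n * (1 - c) - real x - (real x + \<beta>) * c) * meixner_n n x \<beta> c
     - c * real x * (real x - 1 + \<beta>) * meixner_n n (x - 1) \<beta> c"
proof -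
  define w where "w = 1 - 1 / c"
  define m where "m = (\<lambda>x. meixner_poly n x \<beta> w)"
  have w: "c * (1 - w) = 1" "c * w = c - 1" using assms by (auto simp: w_def field_simps)
  have "(real x + \<beta>) * (m (real x + 1) - m (real x)) = real n * w * m (real x) + (1 - w) * (real x * (m (real x) - m (real x - 1)))"
    unfolding m_def by (rule meixner_poly_difference_equation) fact
  from arg_cong[OF this, of "\<lambda>u. c * u"]
  have "c * ((real x + \<beta>) * (m (real x + 1) - m (real x))) = real n * (c * w) * m (real x) + (c * (1 - w)) * (real x * (m (real x) - m (real x - 1)))"
    by (simp only: algebra_simps)
  hence rec: "c * (real x + \<beta>) * m (real x + 1) = (real n * (c - 1) + real x + (real x + \<beta>) * c) * m (real x) - real x * m (real x - 1)"
    unfolding w by (simp add: algebra_simps)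
  have mx: "meixner_n n y \<beta> c = (- c) ^ y * pochhammer \<beta> y * m (real y)" for y
    by (simp add: meixner_n_def meixner_eq_poly m_def w_def)
  have "meixner_n n (Suc x) \<beta> c = - ((- c) ^ x * pochhammer \<beta> x) * (c * (real x + \<beta>) * m (real x + 1))"
    unfolding mx pochhammer_Suc by (simp add: algebra_simps)
  also have "\<dots> = (real n * (1 - c) - real x - (real x + \<beta>) * c) * meixner_n n x \<beta> c + (- c) ^ x * pochhammer \<beta> x * (real x * m (real x - 1))"
    unfolding rec mx by (simp add: algebra_simps)
  \<comment> \<open>At \<open>x = 0\<close> the truncated \<open>x - 1\<close> is harmless because
    of the factor \<open>real x\<close>.\<close>
  also have "(- c) ^ x * pochhammer \<beta> x * (real x * m (real x - 1)) = - c * real x * (real x - 1 + \<beta>) * meixner_n n (x - 1) \<beta> c"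
    by (cases x) (simp_all add: mx pochhammer_Suc algebra_simps)
  finally show ?thesis by simp
qed

lemma meixner_n_mixed:
  assumes "\<beta> > 0" "c > 0"
  shows "meixner_n n (Suc x) \<beta> c = (real n - real x) * meixner_n n x \<beta> c - c * (real n + \<beta>) * meixner_n (Suc n) x \<beta> c"
proof -
  define w where "w = 1 - 1 / c"
  define m where "m = (\<lambda>n x. meixner_poly n x \<beta> w)"
  have w: "c * (1 - w) = 1" "c * w = c - 1" using assms by (auto simp: w_def field_simps)
  have "(real n + \<beta>) * (m (Suc n) (real x) - m n (real x)) + (real n - real x) * w * m n (real x) = (real x + \<beta>) * (m n (real x + 1) - m n (real x))"
    unfolding m_def by (rule meixner_poly_mixed) fact
  hence "c * (real n + \<beta>) * (m (Suc n) (real x) - m n (real x)) + (real n - real x) * (c * w) * m n (real x) = c * (real x + \<beta>) * (m n (real x + 1) - m n (real x))"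
    by (metis (no_types, opaque_lifting) distrib_left mult.assoc mult.left_commute)
  hence rec: "c * (real x + \<beta>) * m n (real x + 1) = c * (real n + \<beta>) * m (Suc n) (real x) - (real n - real x) * m n (real x)"
    unfolding w by (simp add: algebra_simps)
  have mx: "meixner_n n y \<beta> c = (- c) ^ y * pochhammer \<beta> y * m n (real y)" for n y
    by (simp add: meixner_n_def meixner_eq_poly m_def w_def)
  have "meixner_n n (Suc x) \<beta> c = - ((- c) ^ x * pochhammer \<beta> x) * (c * (real x + \<beta>) * m n (real x + 1))"
    unfolding mx pochhammer_Suc by (simp add: algebra_simps)
  thus ?thesis unfolding rec mx by (simp add: algebra_simps)
qed

section \<open>Subexponential growth in the degree\<close>

lemma power_times_limit_0_mult_nat:
  fixes f :: "nat \<Rightarrow> real"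
  assumes "\<And>r. 0 < r \<Longrightarrow> r < 1 \<Longrightarrow> (\<lambda>n. f n * r ^ n) \<longlonglongrightarrow> 0" "0 < r" "r < 1"
  shows "(\<lambda>n. real n * f n * r ^ n) \<longlonglongrightarrow> 0"
proof -
  \<comment> \<open>Half of the exponential decay absorbs the factor \<open>n\<close>, the other
    half is left for \<open>f\<close>.\<close>
  define s where "s = sqrt r"
  have s: "0 < s" "s < 1" "r = s * s" using assms by (auto simp: s_def)
  have "(\<lambda>n. (real n * s ^ n) * (f n * s ^ n)) \<longlonglongrightarrow> 0 * 0"
    using s powser_times_n_limit_0[of s] by (intro tendsto_mult assms(1)) auto
  thus ?thesis by (simp add: s(3) power_mult_distrib mult_ac)
qed

text \<open>By \<open>meixner_n_mixed\<close>, raising \<open>x\<close> costs a factor linear in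
  \<open>n\<close> and a shift of \<open>n\<close>. The factor is paid for by passing to a larger
  \<open>r\<close>, hence the induction over all \<open>r\<close>.\<close>

lemma meixner_n_subexponential:
  assumes "\<beta> > 0" "c > 0" "0 < r" "r < 1"
  shows "(\<lambda>n. meixner_n n x \<beta> c * r ^ n) \<longlonglongrightarrow> 0"
  using assms(3,4)
proof (induction x arbitrary: r)
  case (Suc x)
  have 1: "(\<lambda>n. real n * meixner_n n x \<beta> c * r ^ n) \<longlonglongrightarrow> 0"
    by (rule power_times_limit_0_mult_nat) (use Suc in auto)
  have 2: "(\<lambda>n. meixner_n n x \<beta> c * r ^ n) \<longlonglongrightarrow> 0" by (rule Suc)+
  have 3: "(\<lambda>n. real (Suc n) * meixner_n (Suc n) x \<beta> c * r ^ (Suc n)) \<longlonglongrightarrow> 0"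
    using 1 by (rule LIMSEQ_Suc)
  have 4: "(\<lambda>n. meixner_n (Suc n) x \<beta> c * r ^ (Suc n)) \<longlonglongrightarrow> 0"
    using 2 by (rule LIMSEQ_Suc)
  have "(\<lambda>n. real n * meixner_n n x \<beta> c * r ^ n - real x * (meixner_n n x \<beta> c * r ^ n)
      - c / r * (real (Suc n) * meixner_n (Suc n) x \<beta> c * r ^ (Suc n) + (\<beta> - 1) * (meixner_n (Suc n) x \<beta> c * r ^ (Suc n)))) \<longlonglongrightarrow> 0"
    by (rule tendsto_eq_rhs, (rule tendsto_intros 1 2 3 4)+) simp
  also have "(\<lambda>n. real n * meixner_n n x \<beta> c * r ^ n - real x * (meixner_n n x \<beta> c * r ^ n)
      - c / r * (real (Suc n) * meixner_n (Suc n) x \<beta> c * r ^ (Suc n) + (\<beta> - 1) * (meixner_n (Suc n) x \<beta> c * r ^ (Suc n))))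
      = (\<lambda>n. meixner_n n (Suc x) \<beta> c * r ^ n)"
    using \<open>0 < r\<close> by (intro ext) (simp add: meixner_n_mixed[OF assms(1,2)] field_simps)
  finally show ?case .
qed (simp add: LIMSEQ_realpow_zero)

section \<open>The summation formula\<close>

locale dual_hahn_meixner =
  fixes k1 k2 c :: real and s :: complex
  assumes k1: "0 < k1" and k2: "0 < k2" and c: "0 < c" "c < 1"
begin

text \<open>The polynomial parameters of the theorem are \<open>1 - h\<close>, \<open>b\<close> and
  \<open>p + h\<close>. The first and third add up to \<open>p + 1\<close>, the second and third to
  \<open>2 * k1 + p\<close>, the first two to \<open>2 * k2\<close>.\<close>

definition h :: complex where "h = of_real (k1 - k2) + 1/2"
definition b :: complex where "b = of_real (k1 + k2) - 1/2"
definition z :: complex where "z = of_real (c / (c - 1))"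

definition F :: "int \<Rightarrow> int \<Rightarrow> complex" where
  "F p q = hyp2F1_reg (of_int p + h + s) (of_int p + h - s) (of_int q) z"

definition S :: "nat \<Rightarrow> complex \<Rightarrow> complex" where
  "S n d = cdh n s (1 - h) b d"

text \<open>The part of the summand that depends on neither \<open>x1\<close> nor
  \<open>x2\<close>.\<close>

definition W :: "int \<Rightarrow> nat \<Rightarrow> complex" where
  "W p n = of_real ((1 - c) powr (2 * k1 + of_int p)) *
     (rGamma (of_nat n + 1) * rGamma (of_nat n + (of_int p + 1)) * S n (of_int p + h) * of_real c ^ n)"

definition m1 :: "nat \<Rightarrow> int \<Rightarrow> complex" where
  "m1 x N = of_real (meixner_n (nat N) x (2 * k1) c)"

definition m2 :: "nat \<Rightarrow> nat \<Rightarrow> complex" where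
  "m2 x n = of_real (meixner_n n x (2 * k2) c)"

lemma z_slit: "z \<in> slit_plane"
proof -
  have "c / (c - 1) < 0" using c by (simp add: divide_pos_neg)
  thus ?thesis by (simp add: slit_plane_iff z_def complex_nonpos_Reals_iff)
qed

lemma z_eq: "z * (1 - of_real c) = - of_real c"
proof -
  have "c / (c - 1) * (1 - c) = - c" using c by (simp add: field_simps)
  thus ?thesis unfolding z_def by (metis of_real_1 of_real_diff of_real_minus of_real_mult)
qed

text \<open>Negative degrees \<open>n + p\<close> carry weight 0, so the truncation by
  \<open>nat\<close> in \<open>m1\<close> never matters.\<close>

lemma W_eq_0: "int n + p < 0 \<Longrightarrow> W p n = 0"
proof -
  assume *: "int n + p < 0"
  have "of_nat n + (of_int p + 1) = (of_int (int n + p + 1) :: complex)" by simp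
  moreover have "of_int (int n + p + 1) \<in> (\<int>\<^sub>\<le>\<^sub>0 :: complex set)"
    using * by (intro nonpos_Ints_of_int) simp
  ultimately have "rGamma (of_nat n + (of_int p + 1)) = (0 :: complex)"
    by (simp only: rGamma_eq_zero_iff)
  thus ?thesis by (simp only: W_def mult_zero_left mult_zero_right)
qed

lemma W_sums: "W p sums F p (p + 1)"
proof -
  have "(\<lambda>n. rGamma (of_nat n + 1) * rGamma (of_nat n + (1 - h + (of_int p + h))) * cdh n s (1 - h) b (of_int p + h) * of_real c ^ n)
     sums ((1 - of_real c) powr (- (b + (of_int p + h))) * hyp2F1_reg (of_int p + h + s) (of_int p + h - s) (1 - h + (of_int p + h)) (of_real c / (of_real c - 1)))"
    by (rule cdh_generating_function) (use c in simp)
  moreover have "1 - h + (of_int p + h) = of_int p + 1" by simp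
  moreover have "of_real c / (of_real c - 1) = z" by (simp add: z_def)
  moreover have "b + (of_int p + h) = of_real (2 * k1 + of_int p)" by (simp add: b_def h_def)
  moreover have "(1 - of_real c) powr (- complex_of_real (2 * k1 + of_int p)) = of_real ((1 - c) powr (- (2 * k1 + of_int p)))"
    using c powr_of_real[of "1 - c" "- (2 * k1 + of_int p)"] by simp
  ultimately have "(\<lambda>n. rGamma (of_nat n + 1) * rGamma (of_nat n + (of_int p + 1)) * S n (of_int p + h) * of_real c ^ n)
     sums (of_real ((1 - c) powr (- (2 * k1 + of_int p))) * F p (p + 1))"
    by (simp only: F_def S_def of_int_add of_int_1)
  from sums_mult[OF this, of "of_real ((1 - c) powr (2 * k1 + of_int p))"]
  have "W p sums (of_real ((1 - c) powr (2 * k1 + of_int p)) * (of_real ((1 - c) powr (- (2 * k1 + of_int p))) * F p (p + 1)))"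
    unfolding W_def .
  moreover have "of_real ((1 - c) powr (2 * k1 + of_int p)) * of_real ((1 - c) powr (- (2 * k1 + of_int p))) = (1 :: complex)"
    unfolding of_real_mult[symmetric] powr_add[symmetric] using c by simp
  ultimately show ?thesis by (simp only: mult.assoc[symmetric] mult_1_left)
qed

text \<open>Provides the vanishing boundary term of the telescoping sum below. With
  \<open>c = r * r\<close>, one factor \<open>r ^ n\<close> makes the generating function converge,
  so its terms tend to 0; the other one beats \<open>n\<close> times the Meixner value.\<close>

lemma W_m1_tendsto_0: "(\<lambda>n. of_nat n * W p n * m1 x (int n + p)) \<longlonglongrightarrow> 0"
proof -
  define r where "r = sqrt c"
  have r: "0 < r" "r < 1" "r * r = c" using c by (auto simp: r_def)
  define u where "u = (\<lambda>n. of_real ((1 - c) powr (2 * k1 + of_int p)) *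
     (rGamma (of_nat n + 1) * rGamma (of_nat n + (1 - h + (of_int p + h))) * cdh n s (1 - h) b (of_int p + h) * of_real r ^ n))"
  have "u \<longlonglongrightarrow> 0"
    unfolding u_def
    by (rule tendsto_mult_right_zero, rule summable_LIMSEQ_zero, rule sums_summable, rule cdh_generating_function) (use r in simp)
  moreover have "(\<lambda>n. real n * meixner_n (nat (int n + p)) x (2 * k1) c * r ^ n) \<longlonglongrightarrow> 0"
  proof -
    define f where "f = (\<lambda>N. meixner_n N x (2 * k1) c)"
    have f: "(\<lambda>n. f n * q ^ n) \<longlonglongrightarrow> 0" if "0 < q" "q < 1" for q
      unfolding f_def using k1 c that by (intro meixner_n_subexponential) auto
    have nf: "(\<lambda>n. real n * f n * r ^ n) \<longlonglongrightarrow> 0"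
      by (rule power_times_limit_0_mult_nat[OF f]) (use r in auto)
    have lim: "filterlim (\<lambda>n. nat (int n + p)) at_top at_top"
      unfolding filterlim_at_top
    proof
      fix Z show "\<forall>\<^sub>F n in at_top. Z \<le> nat (int n + p)"
        using eventually_ge_at_top[of "nat (int Z - p)"] by eventually_elim linarith
    qed
    \<comment> \<open>The limits known for degree \<open>N\<close> are taken along
      \<open>N = n + p\<close>; the constant power of \<open>r\<close> undoes the shift in the
      exponent, as soon as \<open>n \<ge> -p\<close>.\<close>
    have "(\<lambda>n. r powr (- of_int p) * (real (nat (int n + p)) * f (nat (int n + p)) * r ^ nat (int n + p)
        - of_int p * (f (nat (int n + p)) * r ^ nat (int n + p)))) \<longlonglongrightarrow> 0"
      by (rule tendsto_eq_rhs,
          (rule tendsto_intros filterlim_compose[OF nf lim] filterlim_compose[OF f[OF r(1,2)] lim])+) simp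
    moreover have "\<forall>\<^sub>F n in sequentially. r powr (- of_int p) * (real (nat (int n + p)) * f (nat (int n + p)) * r ^ nat (int n + p)
        - of_int p * (f (nat (int n + p)) * r ^ nat (int n + p))) = real n * f (nat (int n + p)) * r ^ n"
      using eventually_ge_at_top[of "nat (- p)"]
    proof eventually_elim
      case (elim n)
      have N: "real (nat (int n + p)) = real n + of_int p" using elim by linarith
      have "r powr (- of_int p) * r ^ nat (int n + p) = r powr (- of_int p) * r powr real (nat (int n + p))"
        using r by (simp add: powr_realpow)
      also have "\<dots> = r ^ n"
        unfolding powr_add[symmetric] N using r by (simp add: powr_realpow)
      finally show ?case unfolding N by (simp add: algebra_simps)
    qed
    ultimately show ?thesis unfolding f_def by (rule Lim_transform_eventually)
  qed
  hence "(\<lambda>n. complex_of_real (real n * meixner_n (nat (int n + p)) x (2 * k1) c * r ^ n)) \<longlonglongrightarrow> of_real 0"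
    by (rule tendsto_of_real)
  ultimately have "(\<lambda>n. u n * complex_of_real (real n * meixner_n (nat (int n + p)) x (2 * k1) c * r ^ n)) \<longlonglongrightarrow> 0 * of_real 0"
    by (rule tendsto_mult)
  moreover have "u n * complex_of_real (real n * meixner_n (nat (int n + p)) x (2 * k1) c * r ^ n) = of_nat n * W p n * m1 x (int n + p)" for n
  proof -
    have "complex_of_real c ^ n = of_real r ^ n * of_real r ^ n"
      by (simp flip: power_mult_distrib of_real_mult add: r(3))
    moreover have "1 - h + (of_int p + h) = of_int p + 1" by simp
    ultimately show ?thesis
      by (simp only: u_def W_def m1_def S_def of_real_mult of_real_power of_real_of_nat_eq mult_ac)
  qed
  ultimately show ?thesis by (simp only: of_real_0 mult_zero_left)
qed

text \<open>This is \<open>cdh_Suc\<close> at \<open>e = p + h\<close>, with weights attached.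
  Passing from \<open>p\<close> to \<open>p + 1\<close> brings a factor \<open>1 - c\<close>, which
  turns \<open>z\<close> into \<open>-c\<close>.\<close>

lemma W_shift_p:
  "((of_int p + h) ^ 2 - s ^ 2) * z * W (p + 1) n = - of_real c * (of_nat n + of_real (2 * k1) + of_int p) * W p n + of_nat (Suc n) * W p (Suc n)"
proof -
  define e where "e = of_int p + h"
  define q where "q = complex_of_real ((1 - c) powr (2 * k1 + of_int p))"
  have rec: "S (Suc n) e = (of_int p + 1 + of_nat n) * (of_real (2 * k1) + of_int p + of_nat n) * S n e - (e ^ 2 - s ^ 2) * S n (e + 1)"
    unfolding S_def using cdh_Suc[of n s "1 - h" b e] by (simp add: e_def b_def h_def algebra_simps)
  have "of_real ((1 - c) powr (2 * k1 + of_int (p + 1))) = q * (1 - of_real c)"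
    using c powr_add[of "1 - c" "2 * k1 + of_int p" 1] by (simp add: q_def add.assoc)
  hence zq: "z * of_real ((1 - c) powr (2 * k1 + of_int (p + 1))) = - of_real c * q"
    using z_eq by (simp add: mult_ac)
  define g where "g = rGamma (of_nat n + 1 :: complex)"
  define g' where "g' = rGamma (of_nat n + (of_int p + 2) :: complex)"
  have g1: "of_nat (Suc n) * rGamma (of_nat (Suc n) + 1 :: complex) = g"
    using rGamma_plus1[of "of_nat n + 1 :: complex"] by (simp add: g_def add_ac)
  have g2: "rGamma (of_nat n + (of_int p + 1) :: complex) = (of_nat n + of_int p + 1) * g'"
    using rGamma_plus1[of "of_nat n + (of_int p + 1) :: complex"] by (simp add: g'_def add_ac)
  have g3: "rGamma (of_nat (Suc n) + (of_int p + 1) :: complex) = g'" "rGamma (of_nat n + (of_int (p + 1) + 1) :: complex) = g'"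
    by (simp_all add: g'_def add_ac)
  have e1: "of_int (p + 1) + h = e + 1" by (simp add: e_def)
  have "(e ^ 2 - s ^ 2) * z * W (p + 1) n = (z * of_real ((1 - c) powr (2 * k1 + of_int (p + 1)))) * (g * g' * of_real c ^ n) * ((e ^ 2 - s ^ 2) * S n (e + 1))"
    unfolding W_def g_def[symmetric] g3 e1 by (simp only: mult_ac)
  also have "(e ^ 2 - s ^ 2) * S n (e + 1) = (of_int p + 1 + of_nat n) * (of_real (2 * k1) + of_int p + of_nat n) * S n e - S (Suc n) e"
    using rec by simp
  also have "(z * of_real ((1 - c) powr (2 * k1 + of_int (p + 1)))) * (g * g' * of_real c ^ n) * \<dots> =
     - of_real c * (of_nat n + of_real (2 * k1) + of_int p) * (q * (g * ((of_nat n + of_int p + 1) * g') * S n e * of_real c ^ n))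
     + q * (g * g' * S (Suc n) e * of_real c ^ Suc n)"
    unfolding zq by (simp add: algebra_simps)
  also have "g * g' * S (Suc n) e * of_real c ^ Suc n = of_nat (Suc n) * (rGamma (of_nat (Suc n) + 1) * g' * S (Suc n) e * of_real c ^ Suc n)"
    unfolding g1[symmetric] by (simp only: mult.assoc)
  also have "q * \<dots> = of_nat (Suc n) * W p (Suc n)"
    unfolding W_def g3 q_def e_def by (simp only: mult.left_commute)
  also have "q * (g * ((of_nat n + of_int p + 1) * g') * S n e * of_real c ^ n) = W p n"
    unfolding W_def g2 q_def e_def g_def ..
  finally show ?thesis unfolding e_def .
qed

lemma W_m1_sums: "(\<lambda>n. W p n * m1 x (int n + p)) sums F p (p - int x + 1)"
proof (induction x arbitrary: p)
  case 0
  show ?case using W_sums[of p] by (simp add: m1_def)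
next
  case (Suc x)
  \<comment> \<open>Collects the terms of \<open>W_shift_p\<close> that do not match the Meixner
    relation. It is 0 at \<open>n = 0\<close> and tends to 0, so its differences sum to 0.\<close>
  define D where "D = (\<lambda>n. of_nat n * W p n * m1 x (int n + p))"
  define K where "K = (of_int p + h) ^ 2 - s ^ 2"
  have "D \<longlonglongrightarrow> 0" unfolding D_def by (rule W_m1_tendsto_0)
  hence "(\<lambda>n. D n - D (Suc n)) sums (D 0 - 0)"
    by (rule telescope_sums')
  hence D: "(\<lambda>n. D n - D (Suc n)) sums 0" by (simp add: D_def)
  have "(\<lambda>n. of_int (p - int x) * (W p n * m1 x (int n + p)) + K * z * (W (p + 1) n * m1 x (int n + (p + 1))) + (D n - D (Suc n)))
     sums (of_int (p - int x) * F p (p - int x + 1) + K * z * F (p + 1) (p + 1 - int x + 1) + 0)"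
    by (intro sums_add sums_mult Suc D)
  also have "(\<lambda>n. of_int (p - int x) * (W p n * m1 x (int n + p)) + K * z * (W (p + 1) n * m1 x (int n + (p + 1))) + (D n - D (Suc n)))
     = (\<lambda>n. W p n * m1 (Suc x) (int n + p))"
  proof
    fix n
    have D': "D (Suc n) = of_nat (Suc n) * W p (Suc n) * m1 x (int n + (p + 1))"
      by (simp add: D_def algebra_simps)
    have K: "K * z * (W (p + 1) n * m1 x (int n + (p + 1))) = - of_real c * (of_nat n + of_real (2 * k1) + of_int p) * W p n * m1 x (int n + (p + 1)) + D (Suc n)"
      unfolding D' mult.assoc[symmetric] K_def W_shift_p by (simp add: algebra_simps)
    show "of_int (p - int x) * (W p n * m1 x (int n + p)) + K * z * (W (p + 1) n * m1 x (int n + (p + 1))) + (D n - D (Suc n))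
        = W p n * m1 (Suc x) (int n + p)"
    proof (cases "int n + p < 0")
      case True
      \<comment> \<open>For \<open>n + p = -1\<close> the weight \<open>W (p + 1) n\<close> need not
        vanish, but after \<open>K\<close> its contribution contains \<open>D (Suc n)\<close>, which
        cancels; every other term carries \<open>W p n = 0\<close>.\<close>
      thus ?thesis unfolding K D_def by (simp add: W_eq_0)
    next
      case False
      define N where "N = nat (int n + p)"
      have N: "int n + p = int N" "int n + (p + 1) = int (Suc N)" using False by (auto simp: N_def)
      have n: "of_nat n = of_nat N - (of_int p :: complex)"
        using arg_cong[OF N(1), of "of_int :: int \<Rightarrow> complex"] by (simp add: algebra_simps)
      have m: "m1 (Suc x) (int N) = (of_nat N - of_nat x) * m1 x (int N) - of_real c * (of_nat N + of_real (2 * k1)) * m1 x (int (Suc N))"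
        unfolding m1_def nat_int meixner_n_mixed[OF mult_pos_pos[OF zero_less_numeral k1] c(1)] by simp
      show ?thesis unfolding K D_def unfolding N n m by (simp add: algebra_simps)
    qed
  qed
  also have "of_int (p - int x) * F p (p - int x + 1) + K * z * F (p + 1) (p + 1 - int x + 1) + 0 = F p (p - int (Suc x) + 1)"
    \<comment> \<open>Used with \<open>C = p - x + 1\<close>, so \<open>C - 1 = p - x\<close>, and
      \<open>A * B = K\<close>.\<close>
    using hyp2F1_reg_raise[OF z_slit, of "of_int p + h + s" "of_int p + h - s" "of_int (p - int x + 1)"]
    by (simp add: F_def K_def algebra_simps power2_eq_square)
  finally show ?case .
qed

text \<open>The left-hand side of the theorem; the power \<open>c ^ x2\<close> comes from the
  normalisation of \<open>m2\<close>.\<close>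

definition V :: "int \<Rightarrow> nat \<Rightarrow> nat \<Rightarrow> complex" where
  "V p x1 x2 = of_real c ^ x2 * (S x2 (h + of_nat x1 - of_nat x2) * F p (p + int x2 - int x1 + 1))"

text \<open>In the two difference equations the degree enters as \<open>(n + p) * (1 - c)\<close>
  and \<open>n * (1 - c)\<close>; their difference is free of \<open>n\<close>, so the recurrence
  can be summed term by term.\<close>

lemma W_m1_m2_rec:
  "W p n * m1 x1 (int n + p) * m2 (Suc x2) n =
     W p n * m1 (Suc x1) (int n + p) * m2 x2 n
     + ((of_nat x1 + (of_nat x1 + of_real (2 * k1)) * of_real c) - of_int p * (1 - of_real c)
        - (of_nat x2 + (of_nat x2 + of_real (2 * k2)) * of_real c)) * (W p n * m1 x1 (int n + p) * m2 x2 n)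
     + of_real c * of_nat x1 * (of_nat x1 - 1 + of_real (2 * k1)) * (W p n * m1 (x1 - 1) (int n + p) * m2 x2 n)
     - of_real c * of_nat x2 * (of_nat x2 - 1 + of_real (2 * k2)) * (W p n * m1 x1 (int n + p) * m2 (x2 - 1) n)"
proof (cases "int n + p < 0")
  case False
  define N where "N = nat (int n + p)"
  have N: "int n + p = int N" using False by (auto simp: N_def)
  have n: "of_nat n = of_nat N - (of_int p :: complex)"
    using arg_cong[OF N(1), of "of_int :: int \<Rightarrow> complex"] by (simp add: algebra_simps)
  have 1: "m1 (Suc x1) (int N) = (of_nat N * (1 - of_real c) - of_nat x1 - (of_nat x1 + of_real (2 * k1)) * of_real c) * m1 x1 (int N)
     - of_real c * of_nat x1 * (of_nat x1 - 1 + of_real (2 * k1)) * m1 (x1 - 1) (int N)"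
    unfolding m1_def nat_int meixner_n_rec_x[OF mult_pos_pos[OF zero_less_numeral k1] c(1)] by simp
  have 2: "m2 (Suc x2) n = (of_nat n * (1 - of_real c) - of_nat x2 - (of_nat x2 + of_real (2 * k2)) * of_real c) * m2 x2 n
     - of_real c * of_nat x2 * (of_nat x2 - 1 + of_real (2 * k2)) * m2 (x2 - 1) n"
    unfolding m2_def nat_int meixner_n_rec_x[OF mult_pos_pos[OF zero_less_numeral k2] c(1)] by simp
  show ?thesis unfolding N 1 2 n by (simp only: algebra_simps)
qed (simp add: W_eq_0)

text \<open>The recurrence of \<open>W_m1_m2_rec\<close>, now for the closed form, so that both
  sides of the formula are determined by the case \<open>x2 = 0\<close>.\<close>

lemma V_rec:
  "V p x1 (Suc x2) =
     V p (Suc x1) x2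
     + ((of_nat x1 + (of_nat x1 + of_real (2 * k1)) * of_real c) - of_int p * (1 - of_real c)
        - (of_nat x2 + (of_nat x2 + of_real (2 * k2)) * of_real c)) * V p x1 x2
     + of_real c * of_nat x1 * (of_nat x1 - 1 + of_real (2 * k1)) * V p (x1 - 1) x2
     - of_real c * of_nat x2 * (of_nat x2 - 1 + of_real (2 * k2)) * V p x1 (x2 - 1)"
proof -
  define d where "d = h + of_nat x1 - of_nat x2"
  define q where "q = p + int x2 - int x1 + 1"
  define C A B where "C = (of_int q :: complex)" and "A = of_int p + h + s" and "B = of_int p + h - s"
  have v1: "V p x1 (Suc x2) = of_real c ^ x2 * (of_real c * (S (Suc x2) (d - 1) * F p (q + 1)))"
    by (simp add: V_def d_def q_def algebra_simps)
  have v2: "V p (Suc x1) x2 = of_real c ^ x2 * (S x2 (d + 1) * F p (q - 1))"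
    by (simp add: V_def d_def q_def algebra_simps)
  have v3: "V p x1 x2 = of_real c ^ x2 * (S x2 d * F p q)"
    by (simp add: V_def d_def q_def algebra_simps)
  have v4: "of_nat x1 * V p (x1 - 1) x2 = of_real c ^ x2 * (of_nat x1 * (S x2 (d - 1) * F p (q + 1)))"
    by (cases x1) (simp_all add: V_def d_def q_def algebra_simps)
  have v5: "of_real c * of_nat x2 * V p x1 (x2 - 1) = of_real c ^ x2 * (of_nat x2 * (S (x2 - 1) (d + 1) * F p (q - 1)))"
    by (cases x2) (simp_all add: V_def d_def q_def algebra_simps)
  have f1: "S x2 (d + 1) = S x2 d + of_nat x2 * (of_real (2 * k2) + of_nat x2 - 1) * S (x2 - 1) (d + 1)"
    using cdh_shift_diff[of x2 s "1 - h" b d] by (simp add: S_def b_def h_def algebra_simps)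
  \<comment> \<open>At \<open>e = d - 1\<close> the linear factors of \<open>cdh_Suc\<close> become
    \<open>x1\<close> and \<open>x1 + 2 * k1 - 1\<close>, and
    \<open>e^2 - s^2 = (C - A) * (C - B)\<close>, the coefficient of the contiguous
    relation.\<close>
  have f2: "S (Suc x2) (d - 1) = of_nat x1 * (of_real (2 * k1) + of_nat x1 - 1) * S x2 (d - 1) - (C - A) * (C - B) * S x2 d"
    using cdh_Suc[of x2 s "1 - h" b "d - 1"]
    by (simp add: S_def b_def h_def d_def A_def B_def C_def q_def algebra_simps power2_eq_square)
  have "z * F p (q - 1) - F p (q - 1) + (C - 1) * F p q - (2 * C - A - B - 1) * (z * F p q) + (C - A) * (C - B) * (z * F p (q + 1)) = 0"
    using hyp2F1_reg_contiguous[OF z_slit, of A B C] by (simp add: F_def A_def B_def C_def)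
  \<comment> \<open>Multiplication by \<open>1 - c\<close> replaces \<open>z\<close> by
    \<open>-c\<close> and makes the relation polynomial in \<open>c\<close>.\<close>
  hence "(1 - of_real c) * (z * F p (q - 1) - F p (q - 1) + (C - 1) * F p q - (2 * C - A - B - 1) * (z * F p q) + (C - A) * (C - B) * (z * F p (q + 1))) = 0"
    by simp
  hence "(z * (1 - of_real c)) * F p (q - 1) - (1 - of_real c) * F p (q - 1) + (1 - of_real c) * (C - 1) * F p q
      - (2 * C - A - B - 1) * ((z * (1 - of_real c)) * F p q) + (C - A) * (C - B) * ((z * (1 - of_real c)) * F p (q + 1)) = 0"
    by (simp only: algebra_simps)
  hence f3: "F p (q - 1) = ((1 - of_real c) * (C - 1) + of_real c * (2 * C - A - B - 1)) * F p q - of_real c * (C - A) * (C - B) * F p (q + 1)"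
    unfolding z_eq by (simp add: algebra_simps)
  have co: "(1 - of_real c) * (C - 1) + of_real c * (2 * C - A - B - 1) =
       - (of_nat x1 + (of_nat x1 + of_real (2 * k1)) * of_real c - of_int p * (1 - of_real c)
        - (of_nat x2 + (of_nat x2 + of_real (2 * k2)) * of_real c))"
    by (simp add: C_def A_def B_def q_def h_def algebra_simps)
  define L where "L = of_nat x1 + (of_nat x1 + of_real (2 * k1)) * of_real c - of_int p * (1 - of_real c)
        - (of_nat x2 + (of_nat x2 + of_real (2 * k2)) * complex_of_real c)"
  have f3': "F p (q - 1) = - L * F p q - of_real c * (C - A) * (C - B) * F p (q + 1)"
    using f3 unfolding co L_def .
  have "of_real c * (S (Suc x2) (d - 1) * F p (q + 1)) =
     S x2 (d + 1) * F p (q - 1) + L * (S x2 d * F p q)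
     + of_real c * (of_nat x1 - 1 + of_real (2 * k1)) * (of_nat x1 * (S x2 (d - 1) * F p (q + 1)))
     - (of_nat x2 - 1 + of_real (2 * k2)) * (of_nat x2 * (S (x2 - 1) (d + 1) * F p (q - 1)))"
    unfolding f1 f2 f3' by (simp only: algebra_simps) simp
  hence "of_real c ^ x2 * (of_real c * (S (Suc x2) (d - 1) * F p (q + 1))) =
     of_real c ^ x2 * (S x2 (d + 1) * F p (q - 1)) + L * (of_real c ^ x2 * (S x2 d * F p q))
     + of_real c * (of_nat x1 - 1 + of_real (2 * k1)) * (of_real c ^ x2 * (of_nat x1 * (S x2 (d - 1) * F p (q + 1))))
     - (of_nat x2 - 1 + of_real (2 * k2)) * (of_real c ^ x2 * (of_nat x2 * (S (x2 - 1) (d + 1) * F p (q - 1))))"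
    by (simp only: distrib_left right_diff_distrib mult.left_commute[of "of_real c ^ x2"])
  thus ?thesis unfolding v1[symmetric] v2[symmetric] v3[symmetric] v4[symmetric] v5[symmetric] L_def
    by (simp only: mult_ac)
qed

text \<open>The recurrence reaches back to \<open>x2\<close> and \<open>x2 - 1\<close> and changes
  \<open>x1\<close>, hence strong induction over all \<open>x1\<close>.\<close>

lemma W_m1_m2_sums: "(\<lambda>n. W p n * m1 x1 (int n + p) * m2 x2 n) sums V p x1 x2"
proof (induction x2 arbitrary: x1 rule: less_induct)
  case (less x2)
  show ?case
  proof (cases x2)
    case 0
    show ?thesis using W_m1_sums[of p x1] by (simp add: 0 m2_def V_def S_def)
  next
    case (Suc m)
    show ?thesis unfolding Suc V_rec W_m1_m2_rec
      by (intro sums_add sums_diff sums_mult less) (auto simp: Suc)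
  qed
qed

end

section \<open>The formula in the original normalisation\<close>

theorem theorem3p6:
  fixes k1 k2 c y :: real and x1 x2 :: nat and p :: int and C :: "nat \<Rightarrow> real"
  assumes "0 < k1" and "k1 \<le> k2" and "0 < c" and "c < 1"
    and C: "\<And>n. C n = (-1) ^ (x1 + x2) *
              (c ^ (n + x1) * (1 - c) powr (2 * k1 + of_int p)
                 * pochhammer (2 * k1) x1 * pochhammer (2 * k2) x2)
              * rGamma (of_nat n + 1) * rGamma (of_nat n + of_int p + 1)"
  shows "(\<lambda>n. complex_of_real (C n)
            * cont_dual_hahn n (complex_of_real y)
                (of_real (k2 - k1 + 1/2)) (of_real (k1 + k2 - 1/2)) (of_real (k1 - k2 + of_int p + 1/2))
            * of_real (meixner (nat (int n + p)) x1 (2 * k1) c)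
            * of_real (meixner n x2 (2 * k2) c))
         sums
         (cont_dual_hahn x2 (complex_of_real y)
            (of_real (k2 - k1 + 1/2)) (of_real (k1 + k2 - 1/2))
            (of_real (k1 - k2 + real x1 - real x2 + 1/2))
          * hyp2F1_reg
              (of_real (of_int p + k1 - k2 + 1/2) + \<i> * csqrt (complex_of_real y))
              (of_real (of_int p + k1 - k2 + 1/2) - \<i> * csqrt (complex_of_real y))
              (of_int (p + int x2 - int x1 + 1))
              (of_real (c / (c - 1))))"
proof -
  define s where "s = \<i> * csqrt (complex_of_real y)"
  interpret dual_hahn_meixner k1 k2 c s
    by unfold_locales (use assms in auto)
  have par: "complex_of_real (k2 - k1 + 1/2) = 1 - h" "complex_of_real (k1 + k2 - 1/2) = b"
    "complex_of_real (k1 - k2 + of_int p + 1/2) = of_int p + h"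
    "complex_of_real (k1 - k2 + real x1 - real x2 + 1/2) = h + of_nat x1 - of_nat x2"
    "complex_of_real (of_int p + k1 - k2 + 1/2) = of_int p + h"
    by (simp_all add: h_def b_def)
  have rG: "complex_of_real (rGamma (of_nat n + 1)) = rGamma (of_nat n + 1)"
    "complex_of_real (rGamma (of_nat n + of_int p + 1)) = rGamma (of_nat n + (of_int p + 1))" for n
    by (simp_all flip: rGamma_complex_of_real add: add.assoc)
  \<comment> \<open>\<open>C n\<close> contains only \<open>c ^ (n + x1)\<close>, whereas
    \<open>m1\<close> and \<open>m2\<close> together supply \<open>c ^ (x1 + x2)\<close>; the
    surplus \<open>c ^ x2\<close> is divided out on both sides.\<close>
  have c0: "complex_of_real c ^ x2 \<noteq> 0" using assms by simp
  have "complex_of_real (C n) * cont_dual_hahn n (complex_of_real y) (1 - h) b (of_int p + h)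
            * of_real (meixner (nat (int n + p)) x1 (2 * k1) c) * of_real (meixner n x2 (2 * k2) c)
       = inverse (of_real c ^ x2) * (W p n * m1 x1 (int n + p) * m2 x2 n)" for n
  proof -
    have pc: "(- complex_of_real c) ^ x = (-1) ^ x * of_real c ^ x" for x
      by (simp flip: power_mult_distrib)
    have e: "inverse (of_real c ^ x2) * (W p n * m1 x1 (int n + p) * m2 x2 n) = (inverse (of_real c ^ x2) * of_real c ^ x2) *
      (complex_of_real (C n) * S n (of_int p + h)
            * of_real (meixner (nat (int n + p)) x1 (2 * k1) c) * of_real (meixner n x2 (2 * k2) c))"
      unfolding W_def m1_def m2_def meixner_n_def C of_real_mult rG of_real_power of_real_minus pc power_add
      by (simp only: of_real_1 mult_ac)
    show ?thesis
      by (simp only: e left_inverse[OF c0] mult_1_left S_def cont_dual_hahn_eq_cdh s_def[symmetric])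
  qed
  moreover have "(\<lambda>n. inverse (of_real c ^ x2) * (W p n * m1 x1 (int n + p) * m2 x2 n)) sums (inverse (of_real c ^ x2) * V p x1 x2)"
    by (intro sums_mult W_m1_m2_sums)
  moreover have "inverse (of_real c ^ x2) * V p x1 x2 = cont_dual_hahn x2 (complex_of_real y) (1 - h) b (h + of_nat x1 - of_nat x2)
          * hyp2F1_reg (of_int p + h + \<i> * csqrt (complex_of_real y)) (of_int p + h - \<i> * csqrt (complex_of_real y))
              (of_int (p + int x2 - int x1 + 1)) (of_real (c / (c - 1)))"
    by (simp only: V_def F_def S_def z_def cont_dual_hahn_eq_cdh s_def[symmetric] mult.assoc[symmetric]
        left_inverse[OF c0] mult_1_left)
  ultimately show ?thesis unfolding par by simp
qed

end
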